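(* Let $\lambda$ be a partition with Frobenius notation $\lambda=(p_1,\ldots,p_N\mid q_1,\ldots,q_N)$. Let $(z_k)_k$ be complex numbers indexed by the contents $k$ of boxes of $\lambda$, with $\Re(z_k)\ge 1$ for all such $k$ and $\Re(z_{p_i})>1$, $\Re(z_{-q_i})>1$ for all $1\le i\le N$, and let ${\pmb s}=(s_{ij})\in T(\lambda,\mathbb{C})$ be given by $s_{ij}=z_{j-i}$. Then $$\zeta_{\lambda}({\pmb s})=\sum_{\sigma\in\mathfrak{S}_N}\mathrm{sgn}(\sigma)\sum_{j_1=0}^{q_1}\cdots\sum_{j_N=0}^{q_N}(-1)^{j_1+\cdots+j_N}\prod_{k=1}^{N}\zeta^{\star}(z_{-j_k},z_{-j_k+1},\ldots,z_{-1},z_0,z_1,\ldots,z_{p_{\sigma(k)}})\prod_{k=1}^{N}\zeta(z_{-j_k-1},z_{-j_k-2},\ldots,z_{-q_k}),$$ where $\mathfrak{S}_N$ is the symmetric group on $\{1,\dots,N\}$ and $\zeta(z_{-j_k-1},\ldots,z_{-q_k})$ is interpreted as $1$ when $j_k=q_k$.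
   Context: Euler–Zagier multiple zeta-function and its star variant: $\zeta(s_1,\ldots,s_r)=\sum_{0<m_1<\cdots<m_r}m_1^{-s_1}\cdots m_r^{-s_r}$, $\zeta^{\star}(s_1,\ldots,s_r)=\sum_{0<m_1\le\cdots\le m_r}m_1^{-s_1}\cdots m_r^{-s_r}$. For a partition $\lambda=(\lambda_1\ge\lambda_2\ge\cdots)$ with conjugate $\lambda'$ ($\lambda'_i=\#\{j:\lambda_j\ge i\}$), let $N$ be the number of boxes on the main diagonal of its Young diagram; the Frobenius notation is $\lambda=(p_1,\ldots,p_N\mid q_1,\ldots,q_N)$ with $p_i=\lambda_i-i$, $q_i=\lambda'_i-i$. $T(\lambda,\mathbb{C})$ is the set of fillings of the Young diagram of $\lambda$ by complex numbers, and $\mathrm{SSYT}(\lambda)$ is the set of fillings $M=(m_{ij})$ by positive integers that weakly increase along rows and strictly increase down columns. The Schur multiple zeta-function is $\zeta_\lambda({\pmb s})=\sum_{M\in\mathrm{SSYT}(\lambda)}\prod_{(i,j)\in\lambda}m_{ij}^{-s_{ij}}$. The content of box $(i,j)$ is $j-i$. *)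

theory Defs
  imports "HOL-Analysis.Analysis" "HOL-Combinatorics.Permutations"
begin

definition is_partition :: "nat list \<Rightarrow> bool" where
  "is_partition lam \<longleftrightarrow> sorted_wrt (\<ge>) lam \<and> (\<forall>x\<in>set lam. 0 < x)"

definition part_row :: "nat list \<Rightarrow> nat \<Rightarrow> nat" where
  "part_row lam i = (if 1 \<le> i \<and> i \<le> length lam then lam ! (i - 1) else 0)"

definition conj_part :: "nat list \<Rightarrow> nat \<Rightarrow> nat" where
  "conj_part lam i = card {j. 1 \<le> j \<and> j \<le> length lam \<and> part_row lam j \<ge> i}"

definition young_diagram :: "nat list \<Rightarrow> (nat \<times> nat) set" where
  "young_diagram lam = {(i, j). 1 \<le> i \<and> i \<le> length lam \<and> 1 \<le> j \<and> j \<le> part_row lam i}"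

definition frob_N :: "nat list \<Rightarrow> nat" where
  "frob_N lam = card {i. (i, i) \<in> young_diagram lam}"

definition frob_p :: "nat list \<Rightarrow> nat \<Rightarrow> nat" where
  "frob_p lam i = part_row lam i - i"

definition frob_q :: "nat list \<Rightarrow> nat \<Rightarrow> nat" where
  "frob_q lam i = conj_part lam i - i"

definition SSYT :: "nat list \<Rightarrow> (nat \<times> nat \<Rightarrow> nat) set" where
  "SSYT lam = {M. (\<forall>b\<in>young_diagram lam. 0 < M b)
     \<and> (\<forall>i j. (i, j) \<in> young_diagram lam \<and> (i, Suc j) \<in> young_diagram lam \<longrightarrow> M (i, j) \<le> M (i, Suc j))
     \<and> (\<forall>i j. (i, j) \<in> young_diagram lam \<and> (Suc i, j) \<in> young_diagram lam \<longrightarrow> M (i, j) < M (Suc i, j))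
     \<and> (\<forall>b. b \<notin> young_diagram lam \<longrightarrow> M b = 0)}"

definition schur_mzf :: "nat list \<Rightarrow> (nat \<times> nat \<Rightarrow> complex) \<Rightarrow> complex" where
  "schur_mzf lam s = (\<Sum>\<^sub>\<infinity>M\<in>SSYT lam. \<Prod>b\<in>young_diagram lam. (of_nat (M b) :: complex) powr (- s b))"

text \<open>Euler--Zagier multiple zeta-function and its star variant (empty list gives 1).\<close>
definition mzf :: "complex list \<Rightarrow> complex" where
  "mzf s = (\<Sum>\<^sub>\<infinity>m\<in>{m :: nat list. length m = length s \<and> sorted_wrt (<) m \<and> (\<forall>x\<in>set m. 0 < x)}.
              \<Prod>k<length s. (of_nat (m ! k) :: complex) powr (- (s ! k)))"

definition mzf_star :: "complex list \<Rightarrow> complex" where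
  "mzf_star s = (\<Sum>\<^sub>\<infinity>m\<in>{m :: nat list. length m = length s \<and> sorted_wrt (\<le>) m \<and> (\<forall>x\<in>set m. 0 < x)}.
              \<Prod>k<length s. (of_nat (m ! k) :: complex) powr (- (s ! k)))"

end

(*
  Restrict all entries to be at most n; everything then becomes a polynomial identity in weights
  x m c depending on an entry m and a content c, and the theorem follows by letting n tend to
  infinity, all series being absolutely convergent.

  For the truncated sums, removing the entries equal to n + 1 leaves a tableau on a smaller shape
  that interlaces with the given one.  The same recursion holds for the Jacobi-Trudi determinant
  of complete sums, because one bidiagonal row operation followed by multilinear expansion turns
  the rows for n + 1 into the rows for n.  Multiplying that determinant by the unitriangular matrix
  of signed elementary sums makes every row below the main diagonal of the shape a unit
  vector, and Laplace expansion along these rows leaves the N by N determinant of the hook sums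
  (Giambelli).  Each hook sum is an alternating sum of products of a complete and an
  elementary sum, whose limits are the star and the ordinary zeta values.
*)

theory Submission
  imports Defs "Jordan_Normal_Form.Determinant"
begin

section \<open>Truncated star and ordinary zeta sums, and their inversion relation\<close>

section \<open>Complete and elementary sums\<close>

definition bounded_lists :: "(nat \<Rightarrow> nat \<Rightarrow> bool) \<Rightarrow> nat \<Rightarrow> nat \<Rightarrow> nat list set" where
  "bounded_lists R n k = {m. length m = k \<and> sorted_wrt R m \<and> set m \<subseteq> {1..n}}"

text \<open>The choices \<open>(\<le>)\<close> and \<open>(<)\<close> for \<open>R\<close> truncate
  \<open>mzf_star\<close> and \<open>mzf\<close>. The labels \<open>cs\<close> have an arbitrary
  type, so that they can be contents in the algebra and exponents in the limit.\<close>

definition chain_sum ::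
    "(nat \<Rightarrow> nat \<Rightarrow> bool) \<Rightarrow> (nat \<Rightarrow> 'b \<Rightarrow> 'a::comm_ring_1) \<Rightarrow> nat \<Rightarrow> 'b list \<Rightarrow> 'a" where
  "chain_sum R x n cs = (\<Sum>m\<in>bounded_lists R n (length cs). \<Prod>k<length cs. x (m ! k) (cs ! k))"

lemma finite_bounded_lists: "finite (bounded_lists R n k)"
proof (rule finite_subset)
  show "bounded_lists R n k \<subseteq> {m. set m \<subseteq> {1..n} \<and> length m = k}"
    by (auto simp: bounded_lists_def)
qed (simp add: finite_lists_length_eq)

lemma bounded_lists_0: "bounded_lists R n 0 = {[]}"
  by (auto simp: bounded_lists_def)

lemma chain_sum_Nil [simp]: "chain_sum R x n [] = 1"
  by (simp add: chain_sum_def bounded_lists_0)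

lemma chain_sum_0: "cs \<noteq> [] \<Longrightarrow> chain_sum R x 0 cs = 0"
proof -
  assume "cs \<noteq> []"
  then have "bounded_lists R 0 (length cs) = {}"
    by (auto simp: bounded_lists_def)
  then show ?thesis by (simp add: chain_sum_def)
qed

lemma chain_sum_map: "chain_sum R x n (map f cs) = chain_sum R (\<lambda>m c. x m (f c)) n cs"
  by (simp add: chain_sum_def)

text \<open>The lists are split by whether the last, hence largest, entry is \<open>Suc n\<close>.
  If it is, the others are bounded by \<open>n'\<close>, which is \<open>Suc n\<close> for weak and
  \<open>n\<close> for strict increase.\<close>

lemma chain_sum_snoc_aux:
  assumes B: "bounded_lists R (Suc n) (Suc (length cs)) =
      bounded_lists R n (Suc (length cs)) \<union> (\<lambda>m. m @ [Suc n]) ` bounded_lists R n' (length cs)"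
  shows "chain_sum R x (Suc n) (cs @ [c]) =
    chain_sum R x n (cs @ [c]) + x (Suc n) c * chain_sum R x n' cs"
proof -
  have disj: "bounded_lists R n (Suc (length cs)) \<inter> (\<lambda>m. m @ [Suc n]) ` bounded_lists R n' (length cs) = {}"
    by (auto simp: bounded_lists_def)
  have "(\<Sum>m\<in>(\<lambda>m. m @ [Suc n]) ` bounded_lists R n' (length cs).
            \<Prod>k<Suc (length cs). x (m ! k) ((cs @ [c]) ! k))
      = (\<Sum>m\<in>bounded_lists R n' (length cs). x (Suc n) c * (\<Prod>k<length cs. x (m ! k) (cs ! k)))"
    by (subst sum.reindex)
      (auto simp: inj_on_def bounded_lists_def nth_append mult.commute intro!: sum.cong prod.cong)
  then show ?thesis
    unfolding chain_sum_def length_append_singleton B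
    by (subst sum.union_disjoint[OF _ _ disj])
      (auto simp: finite_bounded_lists sum_distrib_left)
qed

lemma snoc_exists: "length m = Suc k \<Longrightarrow> \<exists>ys y. m = ys @ [y] \<and> length ys = k"
  by (metis append_butlast_last_id diff_Suc_1 length_0_conv length_butlast nat.simps(3))

lemma chain_sum_le_snoc:
  "chain_sum (\<le>) x (Suc n) (cs @ [c]) =
    chain_sum (\<le>) x n (cs @ [c]) + x (Suc n) c * chain_sum (\<le>) x (Suc n) cs"
proof (rule chain_sum_snoc_aux, intro equalityI subsetI)
  fix m assume m: "m \<in> bounded_lists (\<le>) (Suc n) (Suc (length cs))"
  then obtain ys y where y: "m = ys @ [y]" "length ys = length cs"
    using snoc_exists[of m "length cs"] by (auto simp: bounded_lists_def)
  show "m \<in> bounded_lists (\<le>) n (Suc (length cs)) \<union>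
      (\<lambda>m. m @ [Suc n]) ` bounded_lists (\<le>) (Suc n) (length cs)"
  proof (cases "y = Suc n")
    case True
    with m y show ?thesis by (auto simp: bounded_lists_def sorted_wrt_append)
  next
    case False
    with m y show ?thesis by (force simp: bounded_lists_def sorted_wrt_append)
  qed
qed (auto simp: bounded_lists_def sorted_wrt_append subset_iff)

lemma chain_sum_less_snoc:
  "chain_sum (<) x (Suc n) (cs @ [c]) =
    chain_sum (<) x n (cs @ [c]) + x (Suc n) c * chain_sum (<) x n cs"
proof (rule chain_sum_snoc_aux, intro equalityI subsetI)
  fix m assume m: "m \<in> bounded_lists (<) (Suc n) (Suc (length cs))"
  then obtain ys y where y: "m = ys @ [y]" "length ys = length cs"
    using snoc_exists[of m "length cs"] by (auto simp: bounded_lists_def)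
  show "m \<in> bounded_lists (<) n (Suc (length cs)) \<union>
      (\<lambda>m. m @ [Suc n]) ` bounded_lists (<) n (length cs)"
  proof (cases "y = Suc n")
    case True
    with m y show ?thesis by (force simp: bounded_lists_def sorted_wrt_append)
  next
    case False
    with m y show ?thesis by (force simp: bounded_lists_def sorted_wrt_append)
  qed
qed (force simp: bounded_lists_def sorted_wrt_append)+

text \<open>The interval list is empty for every \<open>b < a\<close>, but only
  \<open>b = a - 1\<close> may give 1: the value 0 for smaller \<open>b\<close> is what makes
  \<open>complete_sum_Suc\<close> hold at \<open>b = a - 1\<close>.\<close>

definition complete_sum :: "(nat \<Rightarrow> int \<Rightarrow> 'a::comm_ring_1) \<Rightarrow> nat \<Rightarrow> int \<Rightarrow> int \<Rightarrow> 'a" where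
  "complete_sum x n a b = (if b < a - 1 then 0 else chain_sum (\<le>) x n [a..b])"

lemma complete_sum_Suc:
  "complete_sum x (Suc n) a b = complete_sum x n a b + x (Suc n) b * complete_sum x (Suc n) a (b - 1)"
proof (cases "a \<le> b")
  case True
  then have "[a..b] = [a..b - 1] @ [b]" by (rule upto_rec2)
  with True show ?thesis by (simp add: complete_sum_def chain_sum_le_snoc)
next
  case False
  then show ?thesis by (auto simp: complete_sum_def)
qed

lemma complete_sum_0: "complete_sum x 0 a b = (if b = a - 1 then 1 else 0)"
  by (auto simp: complete_sum_def chain_sum_0)

text \<open>The contents -(j+1), ..., -l form the part of a leg below content -j. The values 1 for
  \<open>j = l\<close> and 0 for \<open>j > l\<close> make the matrix of these sums
  unitriangular.\<close>

definition elementary_sum :: "(nat \<Rightarrow> int \<Rightarrow> 'a::comm_ring_1) \<Rightarrow> nat \<Rightarrow> nat \<Rightarrow> nat \<Rightarrow> 'a" where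
  "elementary_sum x n j l =
    (if j \<le> l then chain_sum (<) x n (map (\<lambda>t. - int t) [Suc j..<Suc l]) else 0)"

lemma elementary_sum_Suc:
  "elementary_sum x (Suc n) j (Suc l) =
    elementary_sum x n j (Suc l) + x (Suc n) (- int (Suc l)) * elementary_sum x n j l"
proof -
  consider "j \<le> l" | "j = Suc l" | "j > Suc l" by linarith
  then show ?thesis
  proof cases
    case 1
    then have "map (\<lambda>t. - int t) [Suc j..<Suc (Suc l)] = map (\<lambda>t. - int t) [Suc j..<Suc l] @ [- int (Suc l)]"
      by simp
    with 1 show ?thesis
      by (simp add: elementary_sum_def chain_sum_less_snoc del: upt_Suc of_nat_Suc)
  qed (auto simp: elementary_sum_def)
qed

lemma elementary_sum_Suc_0: "elementary_sum x n j 0 = (if j = 0 then 1 else 0)"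
  by (auto simp: elementary_sum_def)

lemma elementary_sum_0: "elementary_sum x 0 j l = (if j = l then 1 else 0)"
  by (auto simp: elementary_sum_def chain_sum_0)

text \<open>In the induction step, the mixed sum \<open>V k l\<close> of complete sums bounded by \<open>Suc n\<close> and
  elementary sums bounded by \<open>n\<close> satisfies a recursion in \<open>k\<close> and is a signed monomial.\<close>

lemma sum_complete_elementary:
  assumes "l \<le> L"
  shows "(\<Sum>j\<le>L. (-1) ^ j * complete_sum x n (- int j) (- int (Suc k)) * elementary_sum x n j l)
    = (if k = l then (-1) ^ l else 0)"
  using assms
proof (induction n arbitrary: k l)
  case 0
  have "(\<Sum>j\<le>L. (-1) ^ j * complete_sum x 0 (- int j) (- int (Suc k)) * elementary_sum x 0 j l)
    = (\<Sum>j\<le>L. if j = l then (if k = l then (-1) ^ l else 0) else 0)"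
    by (intro sum.cong) (auto simp: complete_sum_0 elementary_sum_0)
  with 0 show ?case by simp
next
  case (Suc n)
  define V where "V k l = (\<Sum>j\<le>L. (-1) ^ j * complete_sum x (Suc n) (- int j) (- int (Suc k)) *
      elementary_sum x n j l)" for k l
  have rec: "V k l = (if k = l then (-1) ^ l else 0) + x (Suc n) (- int (Suc k)) * V (Suc k) l"
    if "l \<le> L" for k l
  proof -
    have "- int (Suc k) - 1 = - int (Suc (Suc k))" by simp
    then show ?thesis
      unfolding V_def Suc.IH[OF that, symmetric] sum_distrib_left sum.distrib[symmetric]
      by (intro sum.cong refl, subst complete_sum_Suc) (simp add: algebra_simps)
  qed
  \<comment> \<open>If \<open>j \<le> l\<close>, the complete sum ends at -(k+1) < -j - 1 and
    vanishes; if \<open>j > l\<close>, the elementary sum does.\<close>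
  have gt: "V k l = 0" if "k > l" for k l
    unfolding V_def
  proof (intro sum.neutral ballI)
    fix j assume "j \<in> {..L}"
    show "(-1) ^ j * complete_sum x (Suc n) (- int j) (- int (Suc k)) * elementary_sum x n j l = 0"
      using that by (cases "j \<le> l") (auto simp: complete_sum_def elementary_sum_def)
  qed
  have val: "V k l = (-1) ^ l * (\<Prod>t\<in>{k<..l}. x (Suc n) (- int t))" if "k \<le> l" "l \<le> L" for k l
    using that(1)
  proof (induction k rule: inc_induct)
    case base
    show ?case using rec[OF that(2), of l] gt[of l "Suc l"] by simp
  next
    case (step k)
    have "{k<..l} = insert (Suc k) {Suc k<..l}" using step by auto
    then show ?case using rec[OF that(2), of k] step by (simp add: algebra_simps)
  qed
  show ?case
  proof (cases l)
    case 0
    have "(\<Sum>j\<le>L. (-1) ^ j * complete_sum x (Suc n) (- int j) (- int (Suc k)) * elementary_sum x (Suc n) j l)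
      = V k 0" unfolding V_def 0 elementary_sum_Suc_0 by simp
    also have "\<dots> = (if k = l then (-1) ^ l else 0)"
      using val[of k 0] gt[of 0 k] 0 by (cases "k = 0") auto
    finally show ?thesis .
  next
    case (Suc l')
    have "(\<Sum>j\<le>L. (-1) ^ j * complete_sum x (Suc n) (- int j) (- int (Suc k)) * elementary_sum x (Suc n) j l)
      = V k (Suc l') + x (Suc n) (- int (Suc l')) * V k l'"
      unfolding V_def Suc elementary_sum_Suc sum_distrib_left sum.distrib[symmetric]
      by (intro sum.cong) (auto simp: algebra_simps)
    \<comment> \<open>For \<open>k < l\<close> the two signed monomials are opposite and cancel;
      only \<open>k = l\<close> leaves a term.\<close>
    also have "\<dots> = (if k = l then (-1) ^ l else 0)"
    proof -
      consider "k \<le> l'" | "k = Suc l'" | "k > Suc l'" by linarith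
      then show ?thesis
      proof cases
        case 1
        then have "{k<..Suc l'} = insert (Suc l') {k<..l'}" by auto
        with 1 val[of k l'] val[of k "Suc l'"] Suc \<open>l \<le> L\<close> show ?thesis by (simp add: algebra_simps)
      next
        case 2
        with gt[of l' k] val[of k "Suc l'"] Suc \<open>l \<le> L\<close> show ?thesis by simp
      next
        case 3
        with gt[of l' k] gt[of "Suc l'" k] Suc show ?thesis by simp
      qed
    qed
    finally show ?thesis .
  qed
qed

section \<open>Tableaux with bounded entries, and the recursion that strips off the largest
  entry\<close>

section \<open>Truncated Schur sums\<close>

text \<open>Shape data such as \<open>frob_N\<close> and \<open>conj_part\<close> are cardinalities
  of sets closed under positive predecessors; this turns them into bounds on indices.\<close>

lemma initial_segment_eq:
  fixes A :: "nat set"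
  assumes "finite A" "0 \<notin> A" and step: "\<And>j. 1 \<le> j \<Longrightarrow> Suc j \<in> A \<Longrightarrow> j \<in> A"
  shows "A = {1..card A}"
proof (cases "A = {}")
  case False
  have "j \<in> A" if "1 \<le> j" "j \<le> Max A" for j
    using that(2,1)
  proof (induction j rule: inc_induct)
    case base
    show ?case by (rule Max_in[OF assms(1) False])
  next
    case (step k)
    show ?case by (rule assms(3)[OF step.prems step.IH]) simp
  qed
  moreover have "1 \<le> j" if "j \<in> A" for j
    using that assms(2) by (cases "j = 0") simp_all
  moreover have "j \<le> Max A" if "j \<in> A" for j
    using Max_ge[OF assms(1) that] .
  ultimately have A: "A = {1..Max A}" by (simp only: set_eq_iff atLeastAtMost_iff) blast
  have "card {1..Max A} = Max A" by simp
  then show ?thesis using A by (simp only: A[symmetric])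
qed simp

text \<open>A shape is a number of rows with a length function, not a list of positive parts:
  stripping boxes may empty a row while \<open>r\<close>, the size of the determinant, stays
  fixed.\<close>

definition diagram :: "nat \<Rightarrow> (nat \<Rightarrow> nat) \<Rightarrow> (nat \<times> nat) set" where
  "diagram r f = (SIGMA i:{1..r}. {1..f i})"

definition tableaux :: "nat \<Rightarrow> (nat \<Rightarrow> nat) \<Rightarrow> nat \<Rightarrow> (nat \<times> nat \<Rightarrow> nat) set" where
  "tableaux r f n = {M. (\<forall>b\<in>diagram r f. 1 \<le> M b \<and> M b \<le> n)
     \<and> (\<forall>i j. (i, j) \<in> diagram r f \<and> (i, Suc j) \<in> diagram r f \<longrightarrow> M (i, j) \<le> M (i, Suc j))
     \<and> (\<forall>i j. (i, j) \<in> diagram r f \<and> (Suc i, j) \<in> diagram r f \<longrightarrow> M (i, j) < M (Suc i, j))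
     \<and> (\<forall>b. b \<notin> diagram r f \<longrightarrow> M b = 0)}"

definition schur_sum ::
    "(nat \<Rightarrow> int \<Rightarrow> 'a::comm_ring_1) \<Rightarrow> nat \<Rightarrow> nat \<Rightarrow> (nat \<Rightarrow> nat) \<Rightarrow> 'a" where
  "schur_sum x n r f =
    (\<Sum>M\<in>tableaux r f n. \<Prod>(i, j)\<in>diagram r f. x (M (i, j)) (int j - int i))"

text \<open>The row after the last one counts as empty; values beyond \<open>r\<close> must not
  enter, because members of \<open>interlacing\<close> are undefined there.\<close>

definition next_row :: "nat \<Rightarrow> (nat \<Rightarrow> nat) \<Rightarrow> nat \<Rightarrow> nat" where
  "next_row r f i = (if i < r then f (Suc i) else 0)"

definition antitone_rows :: "nat \<Rightarrow> (nat \<Rightarrow> nat) \<Rightarrow> bool" where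
  "antitone_rows r f \<longleftrightarrow> (\<forall>i\<in>{1..r}. next_row r f i \<le> f i)"

text \<open>For antitone rows these are the shapes left after removing a horizontal strip, at most
  one box from each column.\<close>

definition interlacing :: "nat \<Rightarrow> (nat \<Rightarrow> nat) \<Rightarrow> (nat \<Rightarrow> nat) set" where
  "interlacing r f = (\<Pi>\<^sub>E i\<in>{1..r}. {next_row r f i..f i})"

lemma finite_diagram [simp]: "finite (diagram r f)"
  by (simp add: diagram_def)

lemma in_diagram [simp]: "(i, j) \<in> diagram r f \<longleftrightarrow> i \<in> {1..r} \<and> j \<in> {1..f i}"
  by (auto simp: diagram_def)

lemma tableauxI:
  assumes "\<And>i j. i \<in> {1..r} \<Longrightarrow> j \<in> {1..f i} \<Longrightarrow> 1 \<le> M (i, j) \<and> M (i, j) \<le> n"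
    and "\<And>i j. i \<in> {1..r} \<Longrightarrow> 1 \<le> j \<Longrightarrow> Suc j \<le> f i \<Longrightarrow> M (i, j) \<le> M (i, Suc j)"
    and "\<And>i j. 1 \<le> i \<Longrightarrow> Suc i \<le> r \<Longrightarrow> j \<in> {1..f i} \<Longrightarrow> j \<le> f (Suc i) \<Longrightarrow> M (i, j) < M (Suc i, j)"
    and "\<And>b. b \<notin> diagram r f \<Longrightarrow> M b = 0"
  shows "M \<in> tableaux r f n"
  unfolding tableaux_def
proof (intro CollectI conjI allI impI ballI)
  fix b assume "b \<in> diagram r f"
  then obtain i j where "b = (i, j)" "i \<in> {1..r}" "j \<in> {1..f i}" by (cases b) simp
  with assms(1) show "1 \<le> M b" "M b \<le> n" by blast+
next
  fix i j assume "(i, j) \<in> diagram r f \<and> (i, Suc j) \<in> diagram r f"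
  then show "M (i, j) \<le> M (i, Suc j)" by (intro assms(2)) auto
next
  fix i j assume "(i, j) \<in> diagram r f \<and> (Suc i, j) \<in> diagram r f"
  then show "M (i, j) < M (Suc i, j)" by (intro assms(3)) auto
qed (fact assms(4))

lemma tableauxD:
  assumes "M \<in> tableaux r f n"
  shows "i \<in> {1..r} \<Longrightarrow> j \<in> {1..f i} \<Longrightarrow> 1 \<le> M (i, j)"
    and "i \<in> {1..r} \<Longrightarrow> j \<in> {1..f i} \<Longrightarrow> M (i, j) \<le> n"
    and "i \<in> {1..r} \<Longrightarrow> 1 \<le> j \<Longrightarrow> Suc j \<le> f i \<Longrightarrow> M (i, j) \<le> M (i, Suc j)"
    and "1 \<le> i \<Longrightarrow> Suc i \<le> r \<Longrightarrow> j \<in> {1..f i} \<Longrightarrow> j \<le> f (Suc i) \<Longrightarrow> M (i, j) < M (Suc i, j)"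
    and "b \<notin> diagram r f \<Longrightarrow> M b = 0"
proof -
  show "b \<notin> diagram r f \<Longrightarrow> M b = 0"
    using assms unfolding tableaux_def mem_Collect_eq by metis
qed (use assms in \<open>simp_all add: tableaux_def\<close>)

lemma finite_tableaux [simp]: "finite (tableaux r f n)"
proof (rule finite_subset)
  show "tableaux r f n \<subseteq> {M. \<forall>b. (b \<in> diagram r f \<longrightarrow> M b \<in> {..n}) \<and> (b \<notin> diagram r f \<longrightarrow> M b = 0)}"
    by (auto simp: tableaux_def)
qed (rule finite_set_of_finite_funs, auto)

lemma finite_interlacing [simp]: "finite (interlacing r f)"
  by (simp add: interlacing_def finite_PiE)

lemma interlacingD:
  assumes "g \<in> interlacing r f" "i \<in> {1..r}"
  shows "next_row r f i \<le> g i" "g i \<le> f i"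
  using assms by (auto simp: interlacing_def PiE_iff)

lemma antitone_interlacing:
  assumes "g \<in> interlacing r f"
  shows "antitone_rows r g"
proof -
  have "g (Suc i) \<le> g i" if "1 \<le> i" "i < r" for i
    using interlacingD[OF assms, of i] interlacingD[OF assms, of "Suc i"] that
    by (simp add: next_row_def)
  then show ?thesis by (auto simp: antitone_rows_def next_row_def)
qed

text \<open>In each row of a tableau the entries at most \<open>n\<close> form an initial segment,
  so this is the shape they occupy.\<close>

definition rows_upto :: "nat \<Rightarrow> (nat \<Rightarrow> nat) \<Rightarrow> nat \<Rightarrow> (nat \<times> nat \<Rightarrow> nat) \<Rightarrow> nat \<Rightarrow> nat" where
  "rows_upto r f n M = (\<lambda>i\<in>{1..r}. card {j\<in>{1..f i}. M (i, j) \<le> n})"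

lemma rows_upto_iff:
  assumes M: "M \<in> tableaux r f n'" and i: "i \<in> {1..r}" and j: "j \<in> {1..f i}"
  shows "M (i, j) \<le> n \<longleftrightarrow> j \<le> rows_upto r f n M i"
proof -
  have eq: "{j\<in>{1..f i}. M (i, j) \<le> n} = {1..card {j\<in>{1..f i}. M (i, j) \<le> n}}"
  proof (rule initial_segment_eq)
    fix j assume "1 \<le> j" "Suc j \<in> {j \<in> {1..f i}. M (i, j) \<le> n}"
    moreover from this M i have "M (i, j) \<le> M (i, Suc j)"
      by (simp add: tableaux_def)
    ultimately show "j \<in> {j \<in> {1..f i}. M (i, j) \<le> n}" by auto
  qed auto
  show ?thesis using eqset_imp_iff[OF eq, of j] i j by (simp add: rows_upto_def)
qed

lemma rows_upto_interlacing:
  assumes M: "M \<in> tableaux r f (Suc n)" and f: "antitone_rows r f"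
  shows "rows_upto r f n M \<in> interlacing r f"
  unfolding interlacing_def
proof (rule PiE_I)
  fix i assume i: "i \<in> {1..r}"
  have "card {j\<in>{1..f i}. M (i, j) \<le> n} \<le> card {1..f i}" by (rule card_mono) auto
  with i have "rows_upto r f n M i \<le> f i" by (simp add: rows_upto_def)
  moreover have "next_row r f i \<le> rows_upto r f n M i"
  proof (cases "i < r \<and> 1 \<le> f (Suc i)")
    case True
    then have le: "f (Suc i) \<le> f i" using f[unfolded antitone_rows_def, rule_format, OF i]
      by (simp add: next_row_def)
    \<comment> \<open>The last box of row \<open>i\<close> with a box beneath it holds a smaller
      entry than that box, hence at most \<open>n\<close>; so the first \<open>f (Suc i)\<close>
      boxes of row \<open>i\<close> all survive.\<close>
    with M i True have "M (i, f (Suc i)) < M (Suc i, f (Suc i))" "M (Suc i, f (Suc i)) \<le> Suc n"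
      by (simp_all add: tableaux_def)
    then show ?thesis
      using rows_upto_iff[OF M i, of "f (Suc i)" n] le True by (simp add: next_row_def)
  qed (auto simp: next_row_def)
  ultimately show "rows_upto r f n M i \<in> {next_row r f i..f i}" by simp
qed (auto simp: rows_upto_def)

lemma rows_upto_eq_iff:
  assumes M: "M \<in> tableaux r f n'" and g: "g \<in> interlacing r f"
  shows "rows_upto r f n M = g \<longleftrightarrow> (\<forall>i\<in>{1..r}. \<forall>j\<in>{1..f i}. M (i, j) \<le> n \<longleftrightarrow> j \<le> g i)"
    (is "?L \<longleftrightarrow> ?R")
proof
  assume ?L
  with rows_upto_iff[OF M] show ?R by auto
next
  assume R: ?R
  have "rows_upto r f n M i = g i" if i: "i \<in> {1..r}" for i
  proof -
    have "{j\<in>{1..f i}. M (i, j) \<le> n} = {1..g i}"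
      using R i interlacingD[OF g i] by auto
    then show ?thesis using i by (simp add: rows_upto_def)
  qed
  moreover have "g i = undefined" if "i \<notin> {1..r}" for i
    using g that by (auto simp: interlacing_def PiE_iff extensional_def)
  ultimately show ?L by (auto simp: rows_upto_def fun_eq_iff)
qed

text \<open>Restriction to \<open>g\<close> and filling the strip with \<open>Suc n\<close> are
  mutually inverse; the strip contributes the product in front.\<close>

lemma schur_sum_fibre:
  fixes x :: "nat \<Rightarrow> int \<Rightarrow> 'a::comm_ring_1"
  assumes g: "g \<in> interlacing r f"
  shows "(\<Sum>M | M \<in> tableaux r f (Suc n) \<and> rows_upto r f n M = g.
            \<Prod>(i, j)\<in>diagram r f. x (M (i, j)) (int j - int i))
    = (\<Prod>i\<in>{1..r}. \<Prod>j\<in>{g i<..f i}. x (Suc n) (int j - int i)) * schur_sum x n r g"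
proof -
  have gf: "g i \<le> f i" if "i \<in> {1..r}" for i
    using interlacingD(2)[OF g that] .
  have fg: "f (Suc i) \<le> g i" if "1 \<le> i" "Suc i \<le> r" for i
    using interlacingD(1)[OF g, of i] that by (simp add: next_row_def)
  let ?restr = "\<lambda>M b. if b \<in> diagram r g then M b else (0::nat)"
  let ?ext = "\<lambda>M b. if b \<in> diagram r f - diagram r g then Suc n else (M b :: nat)"
  have sub: "diagram r g \<subseteq> diagram r f" using gf by force
  have diff: "diagram r f - diagram r g = (SIGMA i:{1..r}. {g i<..f i})"
    using gf by (auto simp: diagram_def)
  show ?thesis
    unfolding schur_sum_def sum_distrib_left
  proof (rule sum.reindex_bij_witness[of _ ?ext ?restr])
    fix M assume "M \<in> {M. M \<in> tableaux r f (Suc n) \<and> rows_upto r f n M = g}"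
    then have M: "M \<in> tableaux r f (Suc n)" and R: "\<forall>i\<in>{1..r}. \<forall>j\<in>{1..f i}. M (i, j) \<le> n \<longleftrightarrow> j \<le> g i"
      using rows_upto_eq_iff[OF _ g, of M "Suc n"] by blast+
    have top: "M (i, j) = Suc n" if "(i, j) \<in> diagram r f - diagram r g" for i j
    proof -
      from that R have "\<not> M (i, j) \<le> n" by auto
      moreover have "M (i, j) \<le> Suc n" using tableauxD(2)[OF M, of i j] that by simp
      ultimately show ?thesis by simp
    qed
    show "?ext (?restr M) = M"
    proof
      fix b show "?ext (?restr M) b = M b"
        using top tableauxD(5)[OF M, of b] by (cases b) auto
    qed
    show "?restr M \<in> tableaux r g n"
    proof (rule tableauxI)
      fix i j assume ij: "i \<in> {1..r}" "j \<in> {1..g i}"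
      with gf[of i] have "j \<in> {1..f i}" by simp
      with ij R tableauxD(1)[OF M, of i j] show "1 \<le> ?restr M (i, j) \<and> ?restr M (i, j) \<le> n" by simp
    next
      fix i j assume ij: "i \<in> {1..r}" "1 \<le> j" "Suc j \<le> g i"
      with gf[of i] tableauxD(3)[OF M, of i j] show "?restr M (i, j) \<le> ?restr M (i, Suc j)" by simp
    next
      fix i j assume ij: "1 \<le> i" "Suc i \<le> r" "j \<in> {1..g i}" "j \<le> g (Suc i)"
      with gf[of i] gf[of "Suc i"] tableauxD(4)[OF M, of i j]
      show "?restr M (i, j) < ?restr M (Suc i, j)" by simp
    qed simp
    have "(\<Prod>(i, j)\<in>diagram r f. x (M (i, j)) (int j - int i)) =
      (\<Prod>(i, j)\<in>diagram r f - diagram r g. x (M (i, j)) (int j - int i)) *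
      (\<Prod>(i, j)\<in>diagram r g. x (M (i, j)) (int j - int i))"
      by (rule prod.subset_diff[OF sub]) simp
    also have "(\<Prod>(i, j)\<in>diagram r f - diagram r g. x (M (i, j)) (int j - int i)) =
      (\<Prod>(i, j)\<in>diagram r f - diagram r g. x (Suc n) (int j - int i))"
      using top by (intro prod.cong) auto
    also have "\<dots> = (\<Prod>i\<in>{1..r}. \<Prod>j\<in>{g i<..f i}. x (Suc n) (int j - int i))"
      unfolding diff by (subst prod.Sigma) auto
    also have "(\<Prod>(i, j)\<in>diagram r g. x (M (i, j)) (int j - int i)) =
      (\<Prod>(i, j)\<in>diagram r g. x (?restr M (i, j)) (int j - int i))"
      by (intro prod.cong) auto
    finally show "(\<Prod>i\<in>{1..r}. \<Prod>j\<in>{g i<..f i}. x (Suc n) (int j - int i)) *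
        (\<Prod>(i, j)\<in>diagram r g. x (?restr M (i, j)) (int j - int i)) =
      (\<Prod>(i, j)\<in>diagram r f. x (M (i, j)) (int j - int i))" ..
  next
    fix M assume M: "M \<in> tableaux r g n"
    show "?restr (?ext M) = M"
    proof
      fix b show "?restr (?ext M) b = M b"
        using tableauxD(5)[OF M, of b] by simp
    qed
    have bound: "M b \<le> n" for b
      using tableauxD(2)[OF M, of "fst b" "snd b"] tableauxD(5)[OF M, of b]
      by (cases "b \<in> diagram r g"; cases b) simp_all
    have "?ext M \<in> tableaux r f (Suc n)"
    proof (rule tableauxI)
      fix i j assume ij: "i \<in> {1..r}" "j \<in> {1..f i}"
      then show "1 \<le> ?ext M (i, j) \<and> ?ext M (i, j) \<le> Suc n"
        using tableauxD(1)[OF M, of i j] bound[of "(i, j)"] by simp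
    next
      fix i j assume ij: "i \<in> {1..r}" "1 \<le> j" "Suc j \<le> f i"
      then show "?ext M (i, j) \<le> ?ext M (i, Suc j)"
        using tableauxD(3)[OF M, of i j] bound[of "(i, j)"] by simp
    next
      fix i j assume ij: "1 \<le> i" "Suc i \<le> r" "j \<in> {1..f i}" "j \<le> f (Suc i)"
      \<comment> \<open>A box with another beneath it lies in \<open>g\<close> by interlacing, so
        \<open>Suc n\<close> never occurs twice in a column.\<close>
      with fg[of i] have "j \<in> {1..g i}" by simp
      with ij show "?ext M (i, j) < ?ext M (Suc i, j)"
        using tableauxD(4)[OF M, of i j] bound[of "(i, j)"] by simp
    next
      fix b assume "b \<notin> diagram r f"
      with tableauxD(5)[OF M, of b] sub show "?ext M b = 0" by auto
    qed
    moreover have "\<forall>i\<in>{1..r}. \<forall>j\<in>{1..f i}. ?ext M (i, j) \<le> n \<longleftrightarrow> j \<le> g i"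
      using bound by auto
    ultimately show "?ext M \<in> {M. M \<in> tableaux r f (Suc n) \<and> rows_upto r f n M = g}"
      using rows_upto_eq_iff[OF _ g] by blast
  qed
qed

lemma schur_sum_Suc:
  assumes "antitone_rows r f"
  shows "schur_sum x (Suc n) r f = (\<Sum>g\<in>interlacing r f.
    (\<Prod>i\<in>{1..r}. \<Prod>j\<in>{g i<..f i}. x (Suc n) (int j - int i)) * schur_sum x n r g)"
proof -
  have "schur_sum x (Suc n) r f = (\<Sum>g\<in>interlacing r f.
      \<Sum>M | M \<in> tableaux r f (Suc n) \<and> rows_upto r f n M = g.
        \<Prod>(i, j)\<in>diagram r f. x (M (i, j)) (int j - int i))"
    unfolding schur_sum_def
    by (rule sum.group[symmetric]) (auto intro: rows_upto_interlacing assms)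
  then show ?thesis by (simp add: schur_sum_fibre)
qed

lemma schur_sum_0: "schur_sum x 0 r f = (if \<forall>i\<in>{1..r}. f i = 0 then 1 else 0)"
proof (cases "\<forall>i\<in>{1..r}. f i = 0")
  case True
  then have "diagram r f = {}" by (auto simp: diagram_def)
  then have "tableaux r f 0 = {\<lambda>_. 0}" by (auto simp: tableaux_def simp del: in_diagram)
  with \<open>diagram r f = {}\<close> True show ?thesis by (simp add: schur_sum_def)
next
  case False
  then obtain i where "i \<in> {1..r}" "f i \<noteq> 0" by blast
  then have "M \<notin> tableaux r f 0" for M
    using tableauxD(1,2)[of M r f 0 i 1] by fastforce
  then have "tableaux r f 0 = {}" by blast
  with False show ?thesis by (simp add: schur_sum_def)
qed

section \<open>The Jacobi-Trudi determinant for weights that depend on the content\<close>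

section \<open>The Jacobi--Trudi formula\<close>

text \<open>This iterates \<open>complete_sum_Suc\<close> from \<open>m\<close> down to
  \<open>l\<close>. If \<open>m\<close> is the length of row \<open>i\<close> and \<open>l\<close>
  that of the next row, the remainder is a multiple of the entry in the next row of the matrix,
  which a row operation removes.\<close>

lemma complete_sum_telescope:
  assumes "l \<le> m"
  shows "complete_sum x (Suc n) a (int m - i) =
    (\<Sum>g=l..m. (\<Prod>j\<in>{g<..m}. x (Suc n) (int j - i)) * complete_sum x n a (int g - i)) +
    (\<Prod>j\<in>{l..m}. x (Suc n) (int j - i)) * complete_sum x (Suc n) a (int l - i - 1)"
  using assms
proof (induction m rule: dec_induct)
  case base
  show ?case by (simp add: complete_sum_Suc[of x n a "int l - i"])
next
  case (step m)
  have ins: "{g<..Suc m} = insert (Suc m) {g<..m}" if "g \<le> m" for g using that by auto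
  have "(\<Sum>g=l..m. (\<Prod>j\<in>{g<..Suc m}. x (Suc n) (int j - i)) * complete_sum x n a (int g - i)) =
    x (Suc n) (int (Suc m) - i) *
      (\<Sum>g=l..m. (\<Prod>j\<in>{g<..m}. x (Suc n) (int j - i)) * complete_sum x n a (int g - i))"
    unfolding sum_distrib_left by (intro sum.cong) (simp_all add: ins mult.assoc)
  moreover have "int (Suc m) - i - 1 = int m - i" by simp
  then have "complete_sum x (Suc n) a (int (Suc m) - i) = complete_sum x n a (int (Suc m) - i) +
      x (Suc n) (int (Suc m) - i) * complete_sum x (Suc n) a (int m - i)"
    using complete_sum_Suc[of x n a "int (Suc m) - i"] by (simp only:)
  ultimately show ?case
    using step by (simp add: algebra_simps del: of_nat_Suc)
qed

lemma det_eq_zero_row: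
  assumes "A \<in> carrier_mat r r" "k < r" "\<And>j. j < r \<Longrightarrow> A $$ (k, j) = 0"
  shows "Determinant.det A = 0"
proof -
  have "(\<Prod>i = 0..<r. A $$ (i, p i)) = 0" if "p permutes {0..<r}" for p
    using that assms(2,3) by (intro prod_zero) (auto simp: permutes_in_image intro!: bexI[of _ k])
  then show ?thesis by (simp add: det_def'[OF assms(1)])
qed

text \<open>Multilinearity in all rows at once: the product of sums in each Leibniz term is expanded
  over choice functions. \<open>Suc\<close> reconciles matrix indices from 0 with shape rows from
  1.\<close>

lemma det_rows_sum:
  fixes c :: "nat \<Rightarrow> nat \<Rightarrow> 'a::comm_ring_1"
  assumes "\<And>i. finite (I i)"
  shows "Determinant.det (Matrix.mat r r (\<lambda>(i, j). \<Sum>g\<in>I (Suc i). c (Suc i) g * R (Suc i) g j))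
    = (\<Sum>g\<in>Pi\<^sub>E {1..r} I. (\<Prod>i\<in>{1..r}. c i (g i)) *
        Determinant.det (Matrix.mat r r (\<lambda>(i, j). R (Suc i) (g (Suc i)) j)))"
proof -
  let ?P = "{p. p permutes {0..<r}}"
  have shift: "(\<Prod>i = 0..<r. F (Suc i)) = (\<Prod>i\<in>{1..r}. F i)" for F :: "nat \<Rightarrow> 'a"
    by (rule prod.reindex_bij_witness[of _ "\<lambda>i. i - 1" Suc]) auto
  have "Determinant.det (Matrix.mat r r (\<lambda>(i, j). \<Sum>g\<in>I (Suc i). c (Suc i) g * R (Suc i) g j))
    = (\<Sum>p\<in>?P. signof p * (\<Prod>i = 0..<r. \<Sum>g\<in>I (Suc i). c (Suc i) g * R (Suc i) g (p i)))"
    by (subst det_def'[of _ r]) (auto intro!: sum.cong prod.cong arg_cong2[of _ _ _ _ "(*)"])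
  also have "\<dots> = (\<Sum>p\<in>?P. signof p *
      (\<Sum>g\<in>Pi\<^sub>E {1..r} I. \<Prod>i\<in>{1..r}. c i (g i) * R i (g i) (p (i - 1))))"
  proof (intro sum.cong refl arg_cong2[of _ _ _ _ "(*)"])
    fix p :: "nat \<Rightarrow> nat"
    show "(\<Prod>i = 0..<r. \<Sum>g\<in>I (Suc i). c (Suc i) g * R (Suc i) g (p i)) =
      (\<Sum>g\<in>Pi\<^sub>E {1..r} I. \<Prod>i\<in>{1..r}. c i (g i) * R i (g i) (p (i - 1)))"
      using shift[of "\<lambda>i. \<Sum>g\<in>I i. c i g * R i g (p (i - 1))"] assms
      by (simp add: prod_sum_PiE)
  qed
  also have "\<dots> = (\<Sum>g\<in>Pi\<^sub>E {1..r} I. (\<Prod>i\<in>{1..r}. c i (g i)) *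
      (\<Sum>p\<in>?P. signof p * (\<Prod>i\<in>{1..r}. R i (g i) (p (i - 1)))))"
    unfolding sum_distrib_left prod.distrib
    by (subst sum.swap) (simp add: mult_ac)
  also have "\<dots> = (\<Sum>g\<in>Pi\<^sub>E {1..r} I. (\<Prod>i\<in>{1..r}. c i (g i)) *
        Determinant.det (Matrix.mat r r (\<lambda>(i, j). R (Suc i) (g (Suc i)) j)))"
  proof (intro sum.cong refl arg_cong2[of _ _ _ _ "(*)"])
    fix g :: "nat \<Rightarrow> nat"
    have "Determinant.det (Matrix.mat r r (\<lambda>(i, j). R (Suc i) (g (Suc i)) j)) =
      (\<Sum>p\<in>?P. signof p * (\<Prod>i = 0..<r. R (Suc i) (g (Suc i)) (p i)))"
      by (subst det_def'[of _ r]) (auto intro!: sum.cong prod.cong arg_cong2[of _ _ _ _ "(*)"])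
    then show "(\<Sum>p\<in>?P. signof p * (\<Prod>i\<in>{1..r}. R i (g i) (p (i - 1)))) =
      Determinant.det (Matrix.mat r r (\<lambda>(i, j). R (Suc i) (g (Suc i)) j))"
      using shift[of "\<lambda>i. R i (g i) (p (i - 1))" for p] by simp
  qed
  finally show ?thesis .
qed

text \<open>The row operations amount to left multiplication by an upper bidiagonal matrix with unit
  diagonal.\<close>

lemma det_bidiagonal:
  fixes c :: "nat \<Rightarrow> 'a::comm_ring_1"
  assumes A: "A \<in> carrier_mat r r"
  shows "Determinant.det (Matrix.mat r r (\<lambda>(i, j). A $$ (i, j) - (if Suc i < r then c i * A $$ (Suc i, j) else 0)))
    = Determinant.det A"
proof -
  let ?L = "Matrix.mat r r (\<lambda>(i, k). if k = i then 1 else if k = Suc i then - c i else 0)"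
  have "Matrix.mat r r (\<lambda>(i, j). A $$ (i, j) - (if Suc i < r then c i * A $$ (Suc i, j) else 0)) = ?L * A"
  proof (rule eq_matI)
    fix i j assume "i < dim_row (?L * A)" "j < dim_col (?L * A)"
    with A have ij: "i < r" "j < r" by auto
    have "(?L * A) $$ (i, j) =
        (\<Sum>k = 0..<r. (if k = i then A $$ (i, j) else 0) + (if k = Suc i then - c i * A $$ (Suc i, j) else 0))"
      using ij A by (simp add: scalar_prod_def) (intro sum.cong, auto)
    also have "\<dots> = A $$ (i, j) - (if Suc i < r then c i * A $$ (Suc i, j) else 0)"
      using ij by (simp add: sum.distrib)
    finally show "Matrix.mat r r (\<lambda>(i, j). A $$ (i, j) - (if Suc i < r then c i * A $$ (Suc i, j) else 0)) $$ (i, j)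
      = (?L * A) $$ (i, j)" using ij by simp
  qed (use A in auto)
  moreover have "Determinant.det ?L = 1"
    by (subst det_upper_triangular[of _ r]) (auto simp: upper_triangular_def prod_list_diag_prod)
  ultimately show ?thesis using A by (simp add: det_mult[of _ r])
qed

text \<open>Since weights vary with the content, an entry depends on both ends of its content
  interval: column \<open>j\<close> fixes the start and the row fixes the end.\<close>

lemma jacobi_trudi:
  assumes "antitone_rows r f"
  shows "schur_sum x n r f =
    Determinant.det (Matrix.mat r r (\<lambda>(i, j). complete_sum x n (- int j) (int (f (Suc i)) - int (Suc i))))"
  using assms
proof (induction n arbitrary: f)
  case (0 f)
  let ?A = "Matrix.mat r r (\<lambda>(i, j). complete_sum x 0 (- int j) (int (f (Suc i)) - int (Suc i)))"
  show ?case
  proof (cases "\<forall>i\<in>{1..r}. f i = 0")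
    case True
    then have "?A = 1\<^sub>m r"
      by (intro eq_matI) (auto simp: complete_sum_0)
    with True show ?thesis by (simp add: schur_sum_0)
  next
    case False
    have "f i \<le> f 1" if "1 \<le> i" "i \<le> r" for i
      using that
    proof (induction i rule: dec_induct)
      case (step i)
      with 0 have "next_row r f i \<le> f i" by (auto simp: antitone_rows_def)
      with step show ?case by (simp add: next_row_def)
    qed simp
    with False have "0 < r" "0 < f 1" by fastforce+
    \<comment> \<open>With \<open>f 1 > 0\<close> every interval in the first row is nonempty, so
      its sum with bound 0 vanishes.\<close>
    then have "Determinant.det ?A = 0"
      by (intro det_eq_zero_row[of _ r 0]) (auto simp: complete_sum_0)
    with False show ?thesis by (simp add: schur_sum_0)
  qed
next
  case (Suc n f)
  let ?x = "\<lambda>i j. x (Suc n) (int j - int i)"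
  let ?A = "Matrix.mat r r (\<lambda>(i, j). complete_sum x (Suc n) (- int j) (int (f (Suc i)) - int (Suc i)))"
  \<comment> \<open>The coefficient of the remainder in
    \<open>complete_sum_telescope\<close>.\<close>
  let ?c = "\<lambda>i. \<Prod>j\<in>{f (Suc (Suc i))..f (Suc i)}. ?x (Suc i) j"
  let ?K = "Matrix.mat r r (\<lambda>(i, j). \<Sum>g\<in>{next_row r f (Suc i)..f (Suc i)}.
      (\<Prod>j\<in>{g<..f (Suc i)}. ?x (Suc i) j) * complete_sum x n (- int j) (int g - int (Suc i)))"
  have "Matrix.mat r r (\<lambda>(i, j). ?A $$ (i, j) - (if Suc i < r then ?c i * ?A $$ (Suc i, j) else 0)) = ?K"
  proof (rule eq_matI)
    fix i j assume "i < dim_row ?K" "j < dim_col ?K"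
    then have ij: "i < r" "j < r" by auto
    then have le: "next_row r f (Suc i) \<le> f (Suc i)"
      using Suc.prems by (auto simp: antitone_rows_def)
    show "Matrix.mat r r (\<lambda>(i, j). ?A $$ (i, j) - (if Suc i < r then ?c i * ?A $$ (Suc i, j) else 0)) $$ (i, j)
      = ?K $$ (i, j)"
    proof (cases "Suc i < r")
      case True
      have "int (f (Suc (Suc i))) - int (Suc i) - 1 = int (f (Suc (Suc i))) - int (Suc (Suc i))" by simp
      with True ij complete_sum_telescope[OF le, of x n "- int j" "int (Suc i)"] show ?thesis
        by (simp add: next_row_def del: of_nat_Suc)
    next
      case False
      \<comment> \<open>The last row has no successor to subtract; its remainder vanishes because -r
        - 1 < -j - 1 for each column \<open>j < r\<close>.\<close>
      then have "complete_sum x (Suc n) (- int j) (int 0 - int (Suc i) - 1) = 0"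
        using ij by (simp add: complete_sum_def)
      with False ij complete_sum_telescope[OF le, of x n "- int j" "int (Suc i)"] show ?thesis
        by (simp add: next_row_def del: of_nat_Suc)
    qed
  qed auto
  then have "Determinant.det ?A = Determinant.det ?K"
    using det_bidiagonal[of ?A r ?c] by simp
  also have "\<dots> = (\<Sum>g\<in>interlacing r f. (\<Prod>i\<in>{1..r}. \<Prod>j\<in>{g i<..f i}. ?x i j) *
      Determinant.det (Matrix.mat r r (\<lambda>(i, j). complete_sum x n (- int j) (int (g (Suc i)) - int (Suc i)))))"
    unfolding interlacing_def
    by (rule det_rows_sum[where I = "\<lambda>i. {next_row r f i..f i}" and
          c = "\<lambda>i g. \<Prod>j\<in>{g<..f i}. ?x i j" and R = "\<lambda>i g j. complete_sum x n (- int j) (int g - int i)"]) simp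
  also have "\<dots> = schur_sum x (Suc n) r f"
    unfolding schur_sum_Suc[OF Suc.prems]
    by (intro sum.cong refl) (simp add: Suc.IH antitone_interlacing)
  finally show ?case ..
qed

section \<open>From the Jacobi-Trudi determinant to a determinant of hook sums\<close>

section \<open>The Giambelli formula\<close>

text \<open>The classical alternating expansion of the hook with arm \<open>p\<close> and leg
  \<open>q\<close>. The arm is an integer because rows below the diagonal square have negative
  \<open>p\<close>.\<close>

definition hook_sum :: "(nat \<Rightarrow> int \<Rightarrow> 'a::comm_ring_1) \<Rightarrow> nat \<Rightarrow> int \<Rightarrow> nat \<Rightarrow> 'a" where
  "hook_sum x n p q =
    (\<Sum>j\<le>q. (-1) ^ j * complete_sum x n (- int j) p * elementary_sum x n j q)"

text \<open>The inversion relation read as a statement on negative arms: rows below the diagonal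
  square become signed unit vectors.\<close>

lemma hook_sum_neg: "hook_sum x n (- int (Suc k)) l = (if k = l then (-1) ^ l else 0)"
  unfolding hook_sum_def by (rule sum_complete_elementary) simp

lemma det_complete_eq_det_hook:
  "Determinant.det (Matrix.mat r r (\<lambda>(i, j). complete_sum x n (- int j) (b i))) =
    Determinant.det (Matrix.mat r r (\<lambda>(i, l). (-1) ^ l * hook_sum x n (b i) l))"
proof -
  let ?H = "Matrix.mat r r (\<lambda>(i, j). complete_sum x n (- int j) (b i))"
  \<comment> \<open>The sign makes the diagonal entries 1; the price is the factor
    \<open>(-1) ^ l\<close> in column \<open>l\<close> of the product.\<close>
  let ?U = "Matrix.mat r r (\<lambda>(j, l). (-1) ^ (j + l) * elementary_sum x n j l)"
  have "Determinant.det ?U = 1"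
    by (subst det_upper_triangular[of _ r])
      (auto simp: upper_triangular_def prod_list_diag_prod elementary_sum_def)
  moreover have "?H * ?U = Matrix.mat r r (\<lambda>(i, l). (-1) ^ l * hook_sum x n (b i) l)"
  proof (rule eq_matI)
    fix i l
    assume "i < dim_row (Matrix.mat r r (\<lambda>(i, l). (-1) ^ l * hook_sum x n (b i) l))"
      and "l < dim_col (Matrix.mat r r (\<lambda>(i, l). (-1) ^ l * hook_sum x n (b i) l))"
    then have il: "i < r" "l < r" by auto
    then have "(?H * ?U) $$ (i, l) =
        (\<Sum>j\<in>{0..<r}. complete_sum x n (- int j) (b i) * ((-1) ^ (j + l) * elementary_sum x n j l))"
      by (simp add: scalar_prod_def)
    also have "\<dots> = (\<Sum>j\<le>l. complete_sum x n (- int j) (b i) * ((-1) ^ (j + l) * elementary_sum x n j l))"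
      using il by (intro sum.mono_neutral_right) (auto simp: elementary_sum_def)
    also have "\<dots> = (-1) ^ l * hook_sum x n (b i) l"
      unfolding hook_sum_def sum_distrib_left by (intro sum.cong) (simp_all add: power_add mult_ac)
    finally show "(?H * ?U) $$ (i, l) =
        Matrix.mat r r (\<lambda>(i, l). (-1) ^ l * hook_sum x n (b i) l) $$ (i, l)"
      using il by simp
  qed auto
  ultimately show ?thesis
    using det_mult[of ?H r ?U] by simp
qed

lemma det_expand_last_row:
  "Determinant.det (Matrix.mat (Suc n) (Suc n) (\<lambda>(i, l). M i l)) =
    (\<Sum>l<Suc n. M n l * ((-1) ^ (n + l) *
      Determinant.det (Matrix.mat n n (\<lambda>(i, l'). M i (insert_index l l')))))"
proof (subst laplace_expansion_row[of _ "Suc n" n], simp_all only: mat_carrier lessI, intro sum.cong refl)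
  fix l assume "l \<in> {..<Suc n}"
  then have "mat_delete (Matrix.mat (Suc n) (Suc n) (\<lambda>(i, l). M i l)) n l =
      Matrix.mat n n (\<lambda>(i, l'). M i (insert_index l l'))"
    by (intro eq_matI) (auto simp: mat_delete_def insert_index_def)
  with \<open>l \<in> {..<Suc n}\<close>
  show "Matrix.mat (Suc n) (Suc n) (\<lambda>(i, l). M i l) $$ (n, l) *
      cofactor (Matrix.mat (Suc n) (Suc n) (\<lambda>(i, l). M i l)) n l =
    M n l * ((-1) ^ (n + l) * Determinant.det (Matrix.mat n n (\<lambda>(i, l'). M i (insert_index l l'))))"
    by (simp add: cofactor_def)
qed

lemma neg_one_power_cong: "m + 2 * k = n \<Longrightarrow> (-1 :: 'a::ring_1) ^ m = (-1) ^ n"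
  by (auto simp: power_add power_mult)

text \<open>The exponent is n(n-1)/2, written as the sum of legs that occurs in the base case of
  \<open>det_unit_rows\<close>. The induction expands along the last row and reflects the summation
  index.\<close>

lemma det_reverse_columns:
  "Determinant.det (Matrix.mat n n (\<lambda>(i, l). M i l)) = (-1) ^ (\<Sum>k<n. n - Suc k) *
    Determinant.det (Matrix.mat n n (\<lambda>(i, l). M i (n - Suc l)))"
proof (induction n arbitrary: M)
  case (Suc n)
  have comb: "a * (p * (q * d)) = u * (a * (t * d))" if "p * q = u * t" for a p q u t d :: 'a
  proof -
    have "a * (p * (q * d)) = (p * q) * (a * d)" by (simp only: mult_ac)
    also have "\<dots> = (u * t) * (a * d)" by (simp only: that)
    finally show ?thesis by (simp only: mult_ac)
  qed
  have s: "(\<Sum>k<Suc n. Suc n - Suc k) = n + (\<Sum>k<n. n - Suc k)"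
    unfolding sum.lessThan_Suc_shift by simp
  have "Determinant.det (Matrix.mat (Suc n) (Suc n) (\<lambda>(i, l). M i l)) =
    (\<Sum>l<Suc n. M n l * ((-1) ^ (n + l) * ((-1) ^ (\<Sum>k<n. n - Suc k) *
      Determinant.det (Matrix.mat n n (\<lambda>(i, l'). M i (insert_index l (n - Suc l')))))))"
    by (subst det_expand_last_row, subst Suc.IH) (rule refl)
  also have "\<dots> = (\<Sum>l<Suc n. M n (n - l) * ((-1) ^ (n + (n - l)) * ((-1) ^ (\<Sum>k<n. n - Suc k) *
      Determinant.det (Matrix.mat n n (\<lambda>(i, l'). M i (insert_index (n - l) (n - Suc l')))))))"
    by (subst sum.nat_diff_reindex[symmetric]) simp
  also have "\<dots> = (-1) ^ (\<Sum>k<Suc n. Suc n - Suc k) * (\<Sum>l<Suc n. M n (n - l) * ((-1) ^ (n + l) *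
      Determinant.det (Matrix.mat n n (\<lambda>(i, l'). M i (Suc n - Suc (insert_index l l'))))))"
    unfolding sum_distrib_left
  proof (intro sum.cong refl)
    fix l assume l: "l \<in> {..<Suc n}"
    have M1: "Matrix.mat n n (\<lambda>(i, l'). M i (insert_index (n - l) (n - Suc l'))) =
        Matrix.mat n n (\<lambda>(i, l'). M i (Suc n - Suc (insert_index l l')))"
      using l by (intro eq_matI) (auto simp: insert_index_def intro!: arg_cong[of _ _ "M _"])
    have "(-1::'a) ^ (n + (n - l)) * (-1) ^ (\<Sum>k<n. n - Suc k) =
        (-1) ^ (\<Sum>k<Suc n. Suc n - Suc k) * (-1) ^ (n + l)"
    proof -
      have "n + (n - l) + (\<Sum>k<n. n - Suc k) + 2 * l = (\<Sum>k<Suc n. Suc n - Suc k) + (n + l)"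
        using l unfolding s by auto
      then show ?thesis
        unfolding power_add[symmetric] by (rule neg_one_power_cong)
    qed
    then show "M n (n - l) * ((-1) ^ (n + (n - l)) * ((-1) ^ (\<Sum>k<n. n - Suc k) *
        Determinant.det (Matrix.mat n n (\<lambda>(i, l'). M i (insert_index (n - l) (n - Suc l')))))) =
      (-1) ^ (\<Sum>k<Suc n. Suc n - Suc k) * (M n (n - l) * ((-1) ^ (n + l) *
        Determinant.det (Matrix.mat n n (\<lambda>(i, l'). M i (Suc n - Suc (insert_index l l'))))))"
      unfolding M1 by (rule comb)
  qed
  also have "\<dots> = (-1) ^ (\<Sum>k<Suc n. Suc n - Suc k) *
    Determinant.det (Matrix.mat (Suc n) (Suc n) (\<lambda>(i, l). M i (Suc n - Suc l)))"
    by (subst det_expand_last_row) simp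
  finally show ?case .
qed (simp add: det_dim_zero)

text \<open>With rows and columns counted from 0, this is the Frobenius coordinate q of column
  \<open>k + 1\<close>.\<close>

definition column_leg :: "(nat \<Rightarrow> nat) \<Rightarrow> nat \<Rightarrow> nat \<Rightarrow> nat" where
  "column_leg g r k = card {i. i < r \<and> k < g i} - Suc k"

text \<open>The columns \<open>i - g i\<close> of the unit rows and the legs of the columns
  \<open>k < N\<close> together exhaust the \<open>r\<close> column indices. Expansion along the
  unit rows therefore leaves the columns named by the legs, in decreasing order.\<close>

lemma det_unit_rows:
  fixes M :: "nat \<Rightarrow> nat \<Rightarrow> 'a::comm_ring_1"
  assumes "N \<le> r" and "\<And>i. i < N \<Longrightarrow> N \<le> g i" and "\<And>i. N \<le> i \<Longrightarrow> i < r \<Longrightarrow> g i \<le> N"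
    and "\<And>i j. i \<le> j \<Longrightarrow> j < r \<Longrightarrow> g j \<le> g i"
    and "\<And>i l. N \<le> i \<Longrightarrow> i < r \<Longrightarrow> l < r \<Longrightarrow> M i l = (if l = i - g i then 1 else 0)"
  shows "Determinant.det (Matrix.mat r r (\<lambda>(i, l). M i l)) = (-1) ^ (\<Sum>k<N. column_leg g r k) *
    Determinant.det (Matrix.mat N N (\<lambda>(i, k). M i (column_leg g r k)))"
  using assms
proof (induction r arbitrary: M rule: dec_induct)
  case base
  have leg: "column_leg g N k = N - Suc k" if "k < N" for k
  proof -
    have "{i. i < N \<and> k < g i} = {..<N}" using base(1) that by fastforce
    then show ?thesis by (simp add: column_leg_def)
  qed
  have "Matrix.mat N N (\<lambda>(i, k). M i (column_leg g N k)) = Matrix.mat N N (\<lambda>(i, l). M i (N - Suc l))"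
    by (intro eq_matI) (auto simp: leg)
  moreover have "(\<Sum>k<N. column_leg g N k) = (\<Sum>k<N. N - Suc k)" by (simp add: leg)
  ultimately show ?case using det_reverse_columns[of N M] by simp
next
  case (step r)
  define l0 where "l0 = r - g r"
  have gr: "g r \<le> N" using step by simp
  \<comment> \<open>The units of the earlier rows lie to the left of column \<open>l0\<close>, so
    they keep their index when it is deleted.\<close>
  have gi: "i - g i < l0" if "N \<le> i" "i < r" for i
    using step.prems(3)[of i r] gr that step.hyps unfolding l0_def by linarith
  have "Determinant.det (Matrix.mat (Suc r) (Suc r) (\<lambda>(i, l). M i l)) =
      (\<Sum>l<Suc r. if l = l0 then (-1) ^ (r + l0) *
        Determinant.det (Matrix.mat r r (\<lambda>(i, l'). M i (insert_index l0 l'))) else 0)"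
    unfolding det_expand_last_row
    by (intro sum.cong refl) (use step.prems(4)[of r] step.hyps in \<open>auto simp: l0_def\<close>)
  also have "\<dots> = (-1) ^ (r + l0) * Determinant.det (Matrix.mat r r (\<lambda>(i, l'). M i (insert_index l0 l')))"
    by (simp add: l0_def)
  also have "Determinant.det (Matrix.mat r r (\<lambda>(i, l'). M i (insert_index l0 l'))) =
    (-1) ^ (\<Sum>k<N. column_leg g r k) *
      Determinant.det (Matrix.mat N N (\<lambda>(i, k). M i (insert_index l0 (column_leg g r k))))"
  proof (rule step.IH)
    fix i l assume il: "N \<le> i" "i < r" "l < r"
    then show "M i (insert_index l0 l) = (if l = i - g i then 1 else 0)"
      using step.prems(4)[of i "insert_index l0 l"] gi[OF il(1,2)] by (auto simp: insert_index_def)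
  qed (use step.prems in auto)
  also have "(-1) ^ (r + l0) * ((-1) ^ (\<Sum>k<N. column_leg g r k) *
      Determinant.det (Matrix.mat N N (\<lambda>(i, k). M i (insert_index l0 (column_leg g r k))))) =
    (-1) ^ (\<Sum>k<N. column_leg g (Suc r) k) *
      Determinant.det (Matrix.mat N N (\<lambda>(i, k). M i (column_leg g (Suc r) k)))"
  proof -
    \<comment> \<open>Columns \<open>k < g r\<close> gain one box, and their old legs r - 1 - k are
      exactly those not below \<open>l0\<close>; \<open>insert_index l0\<close> shifts precisely
      these by one.\<close>
    have leg: "column_leg g (Suc r) k = column_leg g r k + (if k < g r then 1 else 0)"
      and ins: "insert_index l0 (column_leg g r k) = column_leg g (Suc r) k" if k: "k < N" for k
    proof -
      have sub: "{..<N} \<subseteq> {i. i < r \<and> k < g i}" using step.prems(1) step.hyps k by fastforce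
      then have card: "Suc k \<le> card {i. i < r \<and> k < g i}"
        using card_mono[OF _ sub] k by simp
      have "{i. i < Suc r \<and> k < g i} = {i. i < r \<and> k < g i} \<union> (if k < g r then {r} else {})"
        by (auto simp: less_Suc_eq)
      then show leg: "column_leg g (Suc r) k = column_leg g r k + (if k < g r then 1 else 0)"
        using card by (simp add: column_leg_def Suc_diff_le)
      have "card {i. i < r \<and> k < g i} = r" if "k < g r"
      proof -
        have "{i. i < r \<and> k < g i} = {..<r}" using step.prems(3)[of _ r] that
          by (auto intro: less_le_trans)
        then show ?thesis by simp
      qed
      moreover have "card {i. i < r \<and> k < g i} \<le> r"
        using card_mono[of "{..<r}" "{i. i < r \<and> k < g i}"] by auto
      ultimately show "insert_index l0 (column_leg g r k) = column_leg g (Suc r) k"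
        using leg k step.hyps by (auto simp: insert_index_def column_leg_def l0_def)
    qed
    have "Matrix.mat N N (\<lambda>(i, k). M i (insert_index l0 (column_leg g r k))) =
        Matrix.mat N N (\<lambda>(i, k). M i (column_leg g (Suc r) k))"
      by (intro eq_matI) (auto simp: ins)
    moreover have "(\<Sum>k<N. column_leg g (Suc r) k) = (\<Sum>k<N. column_leg g r k) + g r"
    proof -
      have "{k. k < N \<and> k < g r} = {..<g r}" using gr by auto
      then have "(\<Sum>k<N. if k < g r then 1 else 0) = g r"
        by (simp add: sum.If_cases Int_def)
      then show ?thesis by (simp add: leg sum.distrib)
    qed
    \<comment> \<open>The sign of the expansion matches the growth of the sum of the legs by
      \<open>g r\<close>.\<close>
    moreover have "(-1::'a) ^ (r + l0) = (-1) ^ g r"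
    proof -
      have "g r + 2 * l0 = r + l0" using gr step.hyps by (simp add: l0_def)
      then show ?thesis using neg_one_power_cong by metis
    qed
    ultimately show ?thesis by (simp add: power_add mult_ac)
  qed
  finally show ?case .
qed

text \<open>Here \<open>N\<close> is the side of the diagonal square. The sign from
  \<open>det_unit_rows\<close> and that of the column factors \<open>(-1) ^ l\<close> both have the
  sum of the legs as exponent, so they cancel.\<close>

lemma giambelli:
  fixes x :: "nat \<Rightarrow> int \<Rightarrow> 'a::comm_ring_1"
  assumes f: "antitone_rows r f" and "N \<le> r"
    and ge: "\<And>i. 1 \<le> i \<Longrightarrow> i \<le> N \<Longrightarrow> N \<le> f i"
    and le: "\<And>i. N < i \<Longrightarrow> i \<le> r \<Longrightarrow> f i \<le> N"
  shows "schur_sum x n r f = Determinant.det (Matrix.mat N N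
    (\<lambda>(i, k). hook_sum x n (int (f (Suc i)) - int (Suc i)) (column_leg (\<lambda>i. f (Suc i)) r k)))"
proof -
  let ?g = "\<lambda>i. f (Suc i)"
  let ?M = "\<lambda>i l. (-1) ^ l * hook_sum x n (int (f (Suc i)) - int (Suc i)) l"
  have anti: "?g j \<le> ?g i" if "i \<le> j" "j < r" for i j
    using that
  proof (induction j rule: dec_induct)
    case (step j)
    moreover have "next_row r f (Suc j) \<le> f (Suc j)"
      using f step.prems by (auto simp: antitone_rows_def)
    ultimately show ?case by (simp add: next_row_def)
  qed simp
  have "schur_sum x n r f = Determinant.det (Matrix.mat r r (\<lambda>(i, l). ?M i l))"
    by (simp only: jacobi_trudi[OF f] det_complete_eq_det_hook)
  also have "\<dots> = (-1) ^ (\<Sum>k<N. column_leg ?g r k) *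
      Determinant.det (Matrix.mat N N (\<lambda>(i, k). ?M i (column_leg ?g r k)))"
  proof (rule det_unit_rows)
    fix i l assume i: "N \<le> i" "i < r"
    then have "int (f (Suc i)) - int (Suc i) = - int (Suc (i - f (Suc i)))"
      using le[of "Suc i"] by simp
    \<comment> \<open>The column factor cancels the sign in \<open>hook_sum_neg\<close>.\<close>
    then show "?M i l = (if l = i - f (Suc i) then 1 else 0)"
      by (simp only: hook_sum_neg) (auto simp: power_add[symmetric] simp flip: mult_2)
  qed (use \<open>N \<le> r\<close> ge le anti in auto)
  also have "Determinant.det (Matrix.mat N N (\<lambda>(i, k). ?M i (column_leg ?g r k))) =
    (-1) ^ (\<Sum>k<N. column_leg ?g r k) * Determinant.det (Matrix.mat N N
      (\<lambda>(i, k). hook_sum x n (int (f (Suc i)) - int (Suc i)) (column_leg ?g r k)))"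
  proof -
    have "(\<Prod>i = 0..<N. ?M i (column_leg ?g r (p i))) = (-1) ^ (\<Sum>k<N. column_leg ?g r k) *
        (\<Prod>i = 0..<N. hook_sum x n (int (f (Suc i)) - int (Suc i)) (column_leg ?g r (p i)))"
      if p: "p permutes {0..<N}" for p
    proof -
      have "(\<Prod>i = 0..<N. (-1::'a) ^ column_leg ?g r (p i)) = (\<Prod>k = 0..<N. (-1) ^ column_leg ?g r k)"
        by (rule prod.permute[OF p, symmetric, unfolded o_def])
      then show ?thesis
        by (simp add: prod.distrib power_sum atLeast0LessThan)
    qed
    then show ?thesis
      by (simp add: det_def'[of _ N] sum_distrib_left permutes_in_image mult_ac)
  qed
  finally show ?thesis
    by (simp add: mult.assoc[symmetric] power_add[symmetric] flip: mult_2)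
qed

section \<open>Permutations of {1..N} in determinants, absolute convergence, and limits of truncated
  sums\<close>

section \<open>Convergence\<close>

text \<open>Conjugation by \<open>Suc\<close> preserves signs. The column form of the Leibniz
  formula lets the permutation act on the row index, that is, on the arms.\<close>

lemma det_col_atLeast1:
  fixes A :: "nat \<Rightarrow> nat \<Rightarrow> 'a::comm_ring_1"
  shows "Determinant.det (Matrix.mat N N (\<lambda>(i, k). A (Suc i) (Suc k))) =
    (\<Sum>\<sigma> | \<sigma> permutes {1..N}. of_int (sign \<sigma>) * (\<Prod>k\<in>{1..N}. A (\<sigma> k) k))"
proof -
  have bij: "bij_betw Suc {0..<N} {1..N}" "bij_betw (\<lambda>i. i - 1) {1..N} {0..<N}"
    by (rule bij_betwI[where g = "\<lambda>i. i - 1"] bij_betwI[where g = Suc]; auto)+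
  have inj: "inj_on Suc {0..<N}" by simp
  let ?up = "map_permutation {0..<N} Suc" and ?down = "map_permutation {1..N} (\<lambda>i. i - 1)"
  have "Determinant.det (Matrix.mat N N (\<lambda>(i, k). A (Suc i) (Suc k))) =
      (\<Sum>p | p permutes {0..<N}. of_int (sign p) *
        (\<Prod>k<N. Matrix.mat N N (\<lambda>(i, k). A (Suc i) (Suc k)) $$ (p k, k)))"
    by (rule det_col) simp
  also have "\<dots> = (\<Sum>\<sigma> | \<sigma> permutes {1..N}. of_int (sign \<sigma>) * (\<Prod>k\<in>{1..N}. A (\<sigma> k) k))"
  proof (rule sum.reindex_bij_witness[of _ ?down ?up])
    fix p assume "p \<in> {p. p permutes {0..<N}}"
    then have p: "p permutes {0..<N}" by simp
    show "?down (?up p) = p" by (rule map_permutation_compose_inv[OF bij(1) p]) simp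
    show "?up p \<in> {\<sigma>. \<sigma> permutes {1..N}}" using map_permutation_permutes[OF bij(1) p] by simp
    have "(\<Prod>k\<in>{1..N}. A (?up p k) k) = (\<Prod>k<N. A (?up p (Suc k)) (Suc k))"
      by (rule prod.reindex_bij_witness[of _ Suc "\<lambda>i. i - 1"]) auto
    also have "\<dots> = (\<Prod>k<N. Matrix.mat N N (\<lambda>(i, k). A (Suc i) (Suc k)) $$ (p k, k))"
      using permutes_in_image[OF p]
      by (intro prod.cong refl) (simp add: map_permutation_apply[OF inj])
    finally show "of_int (sign (?up p)) * (\<Prod>k\<in>{1..N}. A (?up p k) k) = of_int (sign p) *
        (\<Prod>k<N. Matrix.mat N N (\<lambda>(i, k). A (Suc i) (Suc k)) $$ (p k, k))"
      using sign_map_permutation[OF inj p] by simp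
  next
    fix p assume "p \<in> {p. p permutes {1..N}}"
    then have p: "p permutes {1..N}" by simp
    show "?up (?down p) = p" by (rule map_permutation_compose_inv[OF bij(2) p]) simp
    show "?down p \<in> {p. p permutes {0..<N}}" using map_permutation_permutes[OF bij(2) p] by simp
  qed
  finally show ?thesis .
qed

text \<open>Each finite subset of \<open>A\<close> lies in some \<open>S m\<close> and in all later
  ones, so \<open>S\<close> is cofinal in the filter that defines \<open>infsum\<close>.\<close>

lemma sum_tendsto_infsum:
  fixes f :: "'a \<Rightarrow> 'b::{comm_monoid_add, t2_space}"
  assumes "f summable_on A" and fin: "\<And>n. finite (S n)" and mono: "\<And>m n. m \<le> n \<Longrightarrow> S m \<subseteq> S n"
    and A: "A = (\<Union>n::nat. S n)"
  shows "(\<lambda>n. sum f (S n)) \<longlonglongrightarrow> infsum f A"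
proof -
  have "filterlim S (finite_subsets_at_top A) sequentially"
    unfolding filterlim_finite_subsets_at_top
  proof (intro allI impI)
    fix X assume X: "finite X \<and> X \<subseteq> A"
    then have "finite X" "X \<subseteq> (\<Union>n. S n)" using A by simp_all
    then have "\<exists>m. X \<subseteq> S m"
    proof (induction X rule: finite_induct)
      case (insert a X)
      then obtain m m' where "X \<subseteq> S m" "a \<in> S m'" by auto
      with mono[of m "max m m'"] mono[of m' "max m m'"] show ?case by auto
    qed auto
    then obtain m where "X \<subseteq> S m" by blast
    then show "\<forall>\<^sub>F n in sequentially. finite (S n) \<and> X \<subseteq> S n \<and> S n \<subseteq> A"
      using fin mono[of m] A by (intro eventually_sequentiallyI[of m]) auto
  qed
  with infsum_tendsto[OF assms(1)] show ?thesis by (rule filterlim_compose)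
qed

text \<open>Vanishing off \<open>B\<close>, the functions are determined on \<open>B\<close>.
  Finitely many of them lie in a box of functions from \<open>B\<close> to a finite set, where the
  sum factors and is bounded by a power of the full series.\<close>

lemma summable_on_prod_functions:
  fixes g :: "nat \<Rightarrow> real"
  assumes "finite B" and g: "summable g" "\<And>n. 0 \<le> g n"
    and S: "\<And>M b. M \<in> S \<Longrightarrow> b \<notin> B \<Longrightarrow> M b = 0"
  shows "(\<lambda>M. \<Prod>b\<in>B. g (M b)) summable_on S"
proof (rule nonneg_bdd_above_summable_on)
  show "0 \<le> (\<Prod>b\<in>B. g (M b))" for M using g(2) by (intro prod_nonneg) auto
  show "bdd_above (sum (\<lambda>M. \<Prod>b\<in>B. g (M b)) ` {F. F \<subseteq> S \<and> finite F})"
  proof (rule bdd_aboveI2)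
    fix F assume "F \<in> {F. F \<subseteq> S \<and> finite F}"
    then have F: "F \<subseteq> S" "finite F" by auto
    define V where "V = (\<Union>M\<in>F. M ` B)"
    have V: "finite V" using F(2) \<open>finite B\<close> by (simp add: V_def)
    have inj: "inj_on (\<lambda>M. restrict M B) F"
    proof (rule inj_onI)
      fix M M' assume M: "M \<in> F" "M' \<in> F" and eq: "restrict M B = restrict M' B"
      show "M = M'"
      proof
        fix b show "M b = M' b"
          using fun_cong[OF eq, of b] S[OF subsetD[OF F(1) M(1)], of b] S[OF subsetD[OF F(1) M(2)], of b]
          by (cases "b \<in> B") auto
      qed
    qed
    have "(\<Sum>M\<in>F. \<Prod>b\<in>B. g (M b)) = (\<Sum>M\<in>(\<lambda>M. restrict M B) ` F. \<Prod>b\<in>B. g (M b))"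
      by (subst sum.reindex[OF inj]) simp
    also have "\<dots> \<le> (\<Sum>M\<in>Pi\<^sub>E B (\<lambda>_. V). \<Prod>b\<in>B. g (M b))"
      using V \<open>finite B\<close> g(2) by (intro sum_mono2 finite_PiE prod_nonneg) (auto simp: V_def)
    also have "\<dots> = (\<Prod>b\<in>B. \<Sum>n\<in>V. g n)"
      using V \<open>finite B\<close> by (intro prod_sum_PiE[symmetric])
    also have "\<dots> \<le> (\<Prod>b\<in>B. suminf g)"
      using V g by (intro prod_mono conjI sum_nonneg sum_le_suminf) auto
    finally show "(\<Sum>M\<in>F. \<Prod>b\<in>B. g (M b)) \<le> (\<Prod>b\<in>B. suminf g)" .
  qed
qed

text \<open>Every entry is dominated by an entry whose exponent exceeds \<open>1\<close>, so the surplus of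
  these exponents can be spread evenly over all entries.\<close>

lemma summable_on_prod_powr:
  fixes s :: "'b \<Rightarrow> complex" and S :: "('b \<Rightarrow> nat) set"
  assumes "finite B"
    and supp: "\<And>M b. M \<in> S \<Longrightarrow> b \<notin> B \<Longrightarrow> M b = 0"
    and pos: "\<And>M b. M \<in> S \<Longrightarrow> b \<in> B \<Longrightarrow> 0 < M b"
    and s: "\<And>b. b \<in> B \<Longrightarrow> 1 \<le> Re (s b)"
    and dom: "\<And>b. b \<in> B \<Longrightarrow> \<exists>c\<in>B. 1 < Re (s c) \<and> (\<forall>M\<in>S. M b \<le> M c)"
  shows "(\<lambda>M. \<Prod>b\<in>B. (of_nat (M b) :: complex) powr (- s b)) summable_on S"
proof -
  from dom have "\<forall>b. \<exists>c. b \<in> B \<longrightarrow> c \<in> B \<and> 1 < Re (s c) \<and> (\<forall>M\<in>S. M b \<le> M c)" by blast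
  then obtain c where c: "b \<in> B \<Longrightarrow> c b \<in> B" "b \<in> B \<Longrightarrow> 1 < Re (s (c b))"
      "b \<in> B \<Longrightarrow> M \<in> S \<Longrightarrow> M b \<le> M (c b)" for b M
    by metis
  \<comment> \<open>The smallest surplus over 1 among the dominating exponents; the inserted 1
    covers empty \<open>B\<close>.\<close>
  define e where "e = Min (insert 1 ((\<lambda>b. Re (s (c b)) - 1) ` B))"
  have e: "0 < e" using \<open>finite B\<close> c(2) by (auto simp: e_def)
  have e_le: "e \<le> Re (s (c b)) - 1" if "b \<in> B" for b
    unfolding e_def using \<open>finite B\<close> that by (intro Min_le) auto
  \<comment> \<open>Summing \<open>e * L b \<le> T\<close> over \<open>B\<close> costs a factor
    \<open>card B\<close>; the added 1 keeps the denominator positive.\<close>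
  define d where "d = e / (1 + real (card B))"
  have d: "0 < d" using e by (simp add: d_def)
  define g where "g n = real n powr (- 1 - d)" for n
  have "summable (\<lambda>n. real n powr (- 1 - d))"
    using summable_real_powr_iff[of "- 1 - d"] d by simp
  then have "summable g" by (simp only: g_def[abs_def])
  then have "(\<lambda>M. \<Prod>b\<in>B. g (M b)) summable_on S"
    by (rule summable_on_prod_functions[OF \<open>finite B\<close>]) (simp_all add: g_def supp)
  moreover have "norm (\<Prod>b\<in>B. (of_nat (M b) :: complex) powr (- s b)) \<le> (\<Prod>b\<in>B. g (M b))"
    if M: "M \<in> S" for M
  proof -
    define L where "L b = ln (real (M b))" for b
    have L0: "0 \<le> L b" if "b \<in> B" for b using pos[OF M that] by (simp add: L_def)
    have Lc: "L b \<le> L (c b)" if "b \<in> B" for b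
      using pos[OF M that] c(3)[OF that M] by (simp add: L_def)
    define T where "T = (\<Sum>b\<in>B. (Re (s b) - 1) * L b)"
    have eT: "e * L b \<le> T" if b: "b \<in> B" for b
    proof -
      have "e * L b \<le> (Re (s (c b)) - 1) * L (c b)"
        using e e_le[OF b] Lc[OF b] L0[OF b] by (intro mult_mono) auto
      also have "\<dots> \<le> T"
        unfolding T_def using \<open>finite B\<close> s L0 c(1)[OF b]
        by (intro member_le_sum[of _ _ "\<lambda>b. (Re (s b) - 1) * L b"]) auto
      finally show ?thesis .
    qed
    have T0: "0 \<le> T" unfolding T_def using s L0 by (intro sum_nonneg) auto
    have "e * (\<Sum>b\<in>B. L b) \<le> (\<Sum>b\<in>B. T)"
      unfolding sum_distrib_left using eT by (rule sum_mono)
    also have "\<dots> \<le> (1 + real (card B)) * T" using T0 by (simp add: algebra_simps)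
    finally have dT: "d * (\<Sum>b\<in>B. L b) \<le> T"
      by (simp add: d_def field_simps)
    have "norm (\<Prod>b\<in>B. (of_nat (M b) :: complex) powr (- s b)) = (\<Prod>b\<in>B. exp (- Re (s b) * L b))"
      unfolding prod_norm[symmetric] using pos[OF M]
      by (intro prod.cong refl) (simp add: norm_powr_real_powr powr_def L_def)
    also have "\<dots> = exp (- T - (\<Sum>b\<in>B. L b))"
      using \<open>finite B\<close> by (simp add: exp_sum[symmetric] T_def algebra_simps sum_subtractf sum_negf)
    also have "\<dots> \<le> exp (- d * (\<Sum>b\<in>B. L b) - (\<Sum>b\<in>B. L b))" using dT by simp
    also have "\<dots> = (\<Prod>b\<in>B. exp ((- 1 - d) * L b))"
      using \<open>finite B\<close> by (simp add: exp_sum[symmetric] algebra_simps sum_subtractf sum_negf sum_distrib_left)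
    also have "\<dots> = (\<Prod>b\<in>B. g (M b))"
      using pos[OF M] by (intro prod.cong refl) (simp add: g_def powr_def L_def)
    finally show ?thesis .
  qed
  ultimately have "(\<lambda>M. norm (\<Prod>b\<in>B. (of_nat (M b) :: complex) powr (- s b))) summable_on S"
    by (rule summable_on_comparison_test) simp_all
  then show ?thesis by (rule abs_summable_summable)
qed

abbreviation zeta_weight :: "nat \<Rightarrow> complex \<Rightarrow> complex" where
  "zeta_weight m s \<equiv> of_nat m powr (- s)"

text \<open>The last entry dominates all others, so only its exponent must exceed 1. Inside, lists
  become functions that are zero past their length, to fit
  \<open>summable_on_prod_powr\<close>.\<close>

lemma chain_sum_tendsto:
  fixes s :: "complex list"
  assumes R: "\<And>i j. R i j \<Longrightarrow> i \<le> j"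
    and s: "\<And>t. t \<in> set s \<Longrightarrow> 1 \<le> Re t" "s \<noteq> [] \<Longrightarrow> 1 < Re (last s)"
  shows "(\<lambda>n. chain_sum R zeta_weight n s) \<longlonglongrightarrow>
    (\<Sum>\<^sub>\<infinity>m\<in>{m :: nat list. length m = length s \<and> sorted_wrt R m \<and> (\<forall>x\<in>set m. 0 < x)}.
      \<Prod>k<length s. zeta_weight (m ! k) (s ! k))"
proof -
  let ?A = "{m :: nat list. length m = length s \<and> sorted_wrt R m \<and> (\<forall>x\<in>set m. 0 < x)}"
  let ?h = "\<lambda>m k. if k < length s then m ! k else (0 :: nat)"
  let ?P = "\<lambda>M. \<Prod>k<length s. zeta_weight (M k) (s ! k)"
  have inj: "inj_on ?h ?A"
  proof (rule inj_onI)
    fix m m' assume m: "m \<in> ?A" "m' \<in> ?A" and eq: "?h m = ?h m'"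
    have "m ! k = m' ! k" if "k < length s" for k using fun_cong[OF eq, of k] that by simp
    with m show "m = m'" by (auto intro: nth_equalityI)
  qed
  have "?P summable_on ?h ` ?A"
  proof (rule summable_on_prod_powr)
    fix k assume k: "k \<in> {..<length s}"
    then show "1 \<le> Re (s ! k)" by (intro s(1)) simp
    from k have "s \<noteq> []" by auto
    have le: "m ! k \<le> m ! (length s - 1)" if "m \<in> ?A" for m
    proof (cases "k = length s - 1")
      case False
      then have "R (m ! k) (m ! (length s - 1))"
        using sorted_wrt_nth_less[of R m k "length s - 1"] that k by simp
      then show ?thesis by (rule R)
    qed simp
    show "\<exists>l\<in>{..<length s}. 1 < Re (s ! l) \<and> (\<forall>M\<in>?h ` ?A. M k \<le> M l)"
    proof (intro bexI conjI ballI)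
      show "1 < Re (s ! (length s - 1))"
        using s(2)[OF \<open>s \<noteq> []\<close>] \<open>s \<noteq> []\<close> by (simp add: last_conv_nth)
      fix M assume "M \<in> ?h ` ?A"
      then obtain m where "m \<in> ?A" "M = ?h m" by blast
      with le[of m] k show "M k \<le> M (length s - 1)" by simp
    qed (use \<open>s \<noteq> []\<close> in simp)
  qed auto
  then have "(\<lambda>m. \<Prod>k<length s. zeta_weight (m ! k) (s ! k)) summable_on ?A"
    by (subst (asm) summable_on_reindex[OF inj]) (simp add: o_def)
  moreover have "?A = (\<Union>n. bounded_lists R n (length s))"
  proof (intro equalityI subsetI)
    fix m assume "m \<in> ?A"
    then have "m \<in> bounded_lists R (Max (set m)) (length s)"
      by (auto simp: bounded_lists_def Suc_le_eq)
    then show "m \<in> (\<Union>n. bounded_lists R n (length s))" by blast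
  qed (auto simp: bounded_lists_def Suc_le_eq subset_eq)
  moreover have "bounded_lists R m (length s) \<subseteq> bounded_lists R n (length s)" if "m \<le> n" for m n
    using that by (auto simp: bounded_lists_def subset_eq dest: le_trans)
  ultimately show ?thesis
    unfolding chain_sum_def by (intro sum_tendsto_infsum finite_bounded_lists)
qed

section \<open>Frobenius coordinates, the Giambelli expansion in terms of them, and the final
  limit\<close>

section \<open>Partitions in Frobenius notation\<close>

lemma young_diagram_eq: "young_diagram lam = diagram (length lam) (part_row lam)"
  by (auto simp: young_diagram_def diagram_def)

lemma tableaux_eq:
  "tableaux (length lam) (part_row lam) n = {M \<in> SSYT lam. \<forall>b\<in>young_diagram lam. M b \<le> n}"
  unfolding tableaux_def SSYT_def young_diagram_eq Suc_le_eq One_nat_def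
  by (auto simp del: in_diagram split_paired_All)

lemma part_row_antitone:
  assumes "is_partition lam" "1 \<le> i" "i \<le> i'"
  shows "part_row lam i' \<le> part_row lam i"
proof (cases "i = i'")
  case False
  with assms show ?thesis
    using sorted_wrt_nth_less[of "(\<ge>)" lam "i - 1" "i' - 1"]
    by (auto simp: is_partition_def part_row_def)
qed simp

lemma antitone_rows_part_row: "is_partition lam \<Longrightarrow> antitone_rows (length lam) (part_row lam)"
  by (auto simp: antitone_rows_def next_row_def part_row_antitone)

lemma in_young_diagram_iff:
  "(i, j) \<in> young_diagram lam \<longleftrightarrow> 1 \<le> i \<and> 1 \<le> j \<and> j \<le> part_row lam i"
  by (auto simp: young_diagram_def part_row_def split: if_splits)

lemma diagonal_iff:
  assumes "is_partition lam"
  shows "1 \<le> i \<and> i \<le> part_row lam i \<longleftrightarrow> i \<in> {1..frob_N lam}"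
proof -
  have eq: "{i. (i, i) \<in> young_diagram lam} = {1..card {i. (i, i) \<in> young_diagram lam}}"
  proof (rule initial_segment_eq)
    show "finite {i. (i, i) \<in> young_diagram lam}"
      by (rule finite_subset[of _ "{..length lam}"]) (auto simp: young_diagram_def)
    fix j assume "1 \<le> j" "Suc j \<in> {i. (i, i) \<in> young_diagram lam}"
    then show "j \<in> {i. (i, i) \<in> young_diagram lam}"
      using part_row_antitone[OF assms, of j "Suc j"] by (auto simp: in_young_diagram_iff)
  qed (simp add: in_young_diagram_iff)
  show ?thesis
    using eqset_imp_iff[OF eq, of i] by (simp add: frob_N_def in_young_diagram_iff)
qed

lemma conj_part_iff:
  assumes "is_partition lam" "1 \<le> j"
  shows "(i, j) \<in> young_diagram lam \<longleftrightarrow> i \<in> {1..conj_part lam j}"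
proof -
  have eq: "{i. 1 \<le> i \<and> i \<le> length lam \<and> part_row lam i \<ge> j} =
      {1..card {i. 1 \<le> i \<and> i \<le> length lam \<and> part_row lam i \<ge> j}}"
  proof (rule initial_segment_eq)
    fix k assume "1 \<le> k" "Suc k \<in> {i. 1 \<le> i \<and> i \<le> length lam \<and> part_row lam i \<ge> j}"
    then show "k \<in> {i. 1 \<le> i \<and> i \<le> length lam \<and> part_row lam i \<ge> j}"
      using part_row_antitone[OF assms(1), of k "Suc k"] by auto
  qed (auto intro: finite_subset[of _ "{..length lam}"])
  show ?thesis
    using eqset_imp_iff[OF eq, of i] assms(2) by (simp add: conj_part_def young_diagram_def conj_ac)
qed

text \<open>The box (i, i) exists for these \<open>i\<close>, so the truncated subtraction in
  \<open>frob_p\<close> is exact.\<close>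

lemma frob_p_eq:
  assumes "is_partition lam" "i \<in> {1..frob_N lam}"
  shows "int (frob_p lam i) = int (part_row lam i) - int i"
  using diagonal_iff[OF assms(1), of i] assms(2) by (simp add: frob_p_def)

lemma frob_q_eq:
  assumes "is_partition lam" "i \<in> {1..frob_N lam}"
  shows "int (frob_q lam i) = int (conj_part lam i) - int i"
proof -
  have "(i, i) \<in> young_diagram lam"
    using diagonal_iff[OF assms(1), of i] assms(2) by (simp add: in_young_diagram_iff)
  with conj_part_iff[OF assms(1), of i i] assms(2) show ?thesis by (simp add: frob_q_def)
qed

lemma frob_q_column_leg: "frob_q lam (Suc k) = column_leg (\<lambda>i. part_row lam (Suc i)) (length lam) k"
proof -
  have "conj_part lam (Suc k) = card {i. i < length lam \<and> k < part_row lam (Suc i)}"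
    unfolding conj_part_def
    by (rule bij_betw_same_card[of "\<lambda>i. i - 1"], rule bij_betwI[where g = Suc]) auto
  then show ?thesis by (simp add: frob_q_def column_leg_def)
qed

text \<open>Together with \<open>content_leg\<close> this supplies a box for every content in a
  hook, where the bound on the real part of \<open>z\<close> then applies.\<close>

lemma content_arm:
  assumes "is_partition lam" "i \<in> {1..frob_N lam}" "t \<le> frob_p lam i"
  shows "(i, i + t) \<in> young_diagram lam"
  using diagonal_iff[OF assms(1), of i] assms by (auto simp: in_young_diagram_iff frob_p_def)

lemma content_leg:
  assumes "is_partition lam" "i \<in> {1..frob_N lam}" "t \<le> frob_q lam i"
  shows "(i + t, i) \<in> young_diagram lam"
  using conj_part_iff[OF assms(1), of i "i + t"] frob_q_eq[OF assms(1,2)] assms(2,3) by auto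

text \<open>The product of hook sums is expanded over choice functions \<open>jj\<close>. As -j
  \<le> 0 \<le> p and j \<le> q, the zero conventions of the complete and elementary sums do not
  intervene; j = q gives the empty list, hence a factor 1.\<close>

lemma giambelli_hooks:
  fixes x :: "nat \<Rightarrow> int \<Rightarrow> 'a::comm_ring_1"
  assumes lam: "is_partition lam"
  shows "schur_sum x n (length lam) (part_row lam) =
    (\<Sum>\<sigma> | \<sigma> permutes {1..frob_N lam}. of_int (sign \<sigma>) *
       (\<Sum>jj \<in> Pi\<^sub>E {1..frob_N lam} (\<lambda>k. {0..frob_q lam k}).
          (-1) ^ (\<Sum>k\<in>{1..frob_N lam}. jj k) *
          (\<Prod>k\<in>{1..frob_N lam}. chain_sum (\<le>) x n [- int (jj k) .. int (frob_p lam (\<sigma> k))]) *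
          (\<Prod>k\<in>{1..frob_N lam}. chain_sum (<) x n (map (\<lambda>t. - int t) [Suc (jj k) ..< Suc (frob_q lam k)]))))"
proof -
  let ?r = "length lam" and ?f = "part_row lam" and ?N = "frob_N lam"
  have diag: "?N \<le> ?f i" if "1 \<le> i" "i \<le> ?N" for i
    using diagonal_iff[OF lam, of ?N] part_row_antitone[OF lam that] that by simp
  have off: "?f i \<le> ?N" if "?N < i" for i
    using diagonal_iff[OF lam, of "Suc ?N"] part_row_antitone[OF lam, of "Suc ?N" i] that by simp
  have "?N \<le> ?r"
    using diag[of ?N] by (cases "?N = 0") (auto simp: part_row_def split: if_splits)
  have "schur_sum x n ?r ?f = Determinant.det (Matrix.mat ?N ?N
      (\<lambda>(i, k). hook_sum x n (int (?f (Suc i)) - int (Suc i)) (column_leg (\<lambda>i. ?f (Suc i)) ?r k)))"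
    using antitone_rows_part_row[OF lam] \<open>?N \<le> ?r\<close> diag off by (rule giambelli)
  also have "\<dots> = Determinant.det (Matrix.mat ?N ?N
      (\<lambda>(i, k). (\<lambda>i k. hook_sum x n (int (?f i) - int i) (frob_q lam k)) (Suc i) (Suc k)))"
    by (simp only: frob_q_column_leg)
  also have "\<dots> = (\<Sum>\<sigma> | \<sigma> permutes {1..?N}. of_int (sign \<sigma>) *
      (\<Prod>k\<in>{1..?N}. hook_sum x n (int (?f (\<sigma> k)) - int (\<sigma> k)) (frob_q lam k)))"
    by (rule det_col_atLeast1)
  also have "\<dots> = (\<Sum>\<sigma> | \<sigma> permutes {1..?N}. of_int (sign \<sigma>) *
      (\<Prod>k\<in>{1..?N}. \<Sum>j\<in>{0..frob_q lam k}. (-1) ^ j *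
        chain_sum (\<le>) x n [- int j .. int (frob_p lam (\<sigma> k))] *
        chain_sum (<) x n (map (\<lambda>t. - int t) [Suc j ..< Suc (frob_q lam k)])))"
  proof (intro sum.cong prod.cong refl arg_cong2[of _ _ _ _ "(*)"])
    fix \<sigma> k assume "\<sigma> \<in> {\<sigma>. \<sigma> permutes {1..?N}}" "k \<in> {1..?N}"
    then have "\<sigma> k \<in> {1..?N}" by (simp only: mem_Collect_eq permutes_in_image)
    then have p: "int (?f (\<sigma> k)) - int (\<sigma> k) = int (frob_p lam (\<sigma> k))"
      using frob_p_eq[OF lam] by simp
    show "hook_sum x n (int (?f (\<sigma> k)) - int (\<sigma> k)) (frob_q lam k) =
      (\<Sum>j\<in>{0..frob_q lam k}. (-1) ^ j *
        chain_sum (\<le>) x n [- int j .. int (frob_p lam (\<sigma> k))] *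
        chain_sum (<) x n (map (\<lambda>t. - int t) [Suc j ..< Suc (frob_q lam k)]))"
      unfolding p hook_sum_def atLeast0AtMost
      by (intro sum.cong refl) (simp add: complete_sum_def elementary_sum_def del: upt_Suc)
  qed
  also have "\<dots> = (\<Sum>\<sigma> | \<sigma> permutes {1..?N}. of_int (sign \<sigma>) *
       (\<Sum>jj \<in> Pi\<^sub>E {1..?N} (\<lambda>k. {0..frob_q lam k}).
          (-1) ^ (\<Sum>k\<in>{1..?N}. jj k) *
          (\<Prod>k\<in>{1..?N}. chain_sum (\<le>) x n [- int (jj k) .. int (frob_p lam (\<sigma> k))]) *
          (\<Prod>k\<in>{1..?N}. chain_sum (<) x n (map (\<lambda>t. - int t) [Suc (jj k) ..< Suc (frob_q lam k)]))))"
    by (simp add: prod_sum_PiE prod.distrib power_sum del: upt_Suc)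
  finally show ?thesis .
qed

lemma SSYT_row_mono:
  assumes "M \<in> SSYT lam" "1 \<le> i" "1 \<le> j" "j \<le> j'" "j' \<le> part_row lam i"
  shows "M (i, j) \<le> M (i, j')"
  using assms(4,5)
proof (induction j' rule: dec_induct)
  case (step j')
  with assms have "M (i, j') \<le> M (i, Suc j')"
    by (simp add: SSYT_def in_young_diagram_iff)
  with step show ?case by simp
qed simp

lemma SSYT_col_mono:
  assumes "M \<in> SSYT lam" "is_partition lam" "1 \<le> i" "1 \<le> j" "i \<le> i'" "i' \<le> conj_part lam j"
  shows "M (i, j) \<le> M (i', j)"
  using assms(5,6)
proof (induction i' rule: dec_induct)
  case (step i')
  then have "(i', j) \<in> young_diagram lam" "(Suc i', j) \<in> young_diagram lam"
    using assms conj_part_iff[OF assms(2,4)] by simp_all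
  with assms(1) have "M (i', j) < M (Suc i', j)" by (simp add: SSYT_def)
  with step show ?case by simp
qed simp

lemma schur_sum_tendsto:
  fixes z :: "int \<Rightarrow> complex"
  assumes lam: "is_partition lam"
    and z: "\<And>i j. (i, j) \<in> young_diagram lam \<Longrightarrow> Re (z (int j - int i)) \<ge> 1"
    and zp: "\<And>i. i \<in> {1..frob_N lam} \<Longrightarrow> Re (z (int (frob_p lam i))) > 1"
    and zq: "\<And>i. i \<in> {1..frob_N lam} \<Longrightarrow> Re (z (- int (frob_q lam i))) > 1"
  shows "(\<lambda>n. schur_sum (\<lambda>m c. zeta_weight m (z c)) n (length lam) (part_row lam))
    \<longlonglongrightarrow> schur_mzf lam (\<lambda>(i, j). z (int j - int i))"
proof -
  let ?s = "\<lambda>(i, j). z (int j - int i)" and ?D = "young_diagram lam"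
  have fin: "finite ?D" by (simp add: young_diagram_eq)
  have "(\<lambda>M. \<Prod>b\<in>?D. zeta_weight (M b) (?s b)) summable_on SSYT lam"
  proof (rule summable_on_prod_powr[OF fin])
    fix b assume b: "b \<in> ?D"
    then obtain i j where ij: "b = (i, j)" "1 \<le> i" "1 \<le> j" "j \<le> part_row lam i"
      by (cases b) (auto simp: in_young_diagram_iff)
    show "1 \<le> Re (?s b)" using z b ij by simp
    \<comment> \<open>For i \<le> N the end of row \<open>i\<close>, of content p_i, dominates. For
      i > N the box lies in a column j \<le> N, whose foot has content -q_j.\<close>
    show "\<exists>c\<in>?D. 1 < Re (?s c) \<and> (\<forall>M\<in>SSYT lam. M b \<le> M c)"
    proof (cases "i \<le> frob_N lam")
      case True
      then have "1 < Re (?s (i, part_row lam i))"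
        using zp[of i] frob_p_eq[OF lam, of i] ij by simp
      with ij show ?thesis
        by (intro bexI[of _ "(i, part_row lam i)"]) (auto simp: in_young_diagram_iff SSYT_row_mono)
    next
      case False
      then have "j < i"
        using diagonal_iff[OF lam, of i] ij by (meson atLeastAtMost_iff le_less_trans not_le)
      moreover have "part_row lam i \<le> part_row lam j"
        using part_row_antitone[OF lam] ij \<open>j < i\<close> by simp
      ultimately have j: "j \<in> {1..frob_N lam}"
        using diagonal_iff[OF lam, of j] ij by simp
      have i: "i \<in> {1..conj_part lam j}"
        using conj_part_iff[OF lam ij(3), of i] b ij(1) by simp
      have "1 < Re (?s (conj_part lam j, j))"
        using zq[OF j] frob_q_eq[OF lam j] by simp
      moreover have "(conj_part lam j, j) \<in> ?D"
        using conj_part_iff[OF lam ij(3)] i by simp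
      moreover have "M b \<le> M (conj_part lam j, j)" if "M \<in> SSYT lam" for M
        using SSYT_col_mono[OF that lam] ij i by simp
      ultimately show ?thesis by blast
    qed
  qed (auto simp: SSYT_def)
  moreover have "SSYT lam = (\<Union>n. tableaux (length lam) (part_row lam) n)"
  proof -
    have "M \<in> tableaux (length lam) (part_row lam) (Max (M ` ?D))" if "M \<in> SSYT lam" for M
      using that fin by (simp add: tableaux_eq)
    then show ?thesis by (auto simp: tableaux_eq)
  qed
  moreover have "tableaux (length lam) (part_row lam) m \<subseteq> tableaux (length lam) (part_row lam) n"
    if "m \<le> n" for m n using that by (auto simp: tableaux_eq intro: order_trans)
  ultimately have "(\<lambda>n. \<Sum>M\<in>tableaux (length lam) (part_row lam) n. \<Prod>b\<in>?D. zeta_weight (M b) (?s b))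
      \<longlonglongrightarrow> schur_mzf lam ?s"
    unfolding schur_mzf_def by (intro sum_tendsto_infsum finite_tableaux)
  then show ?thesis
    by (simp add: schur_sum_def young_diagram_eq case_prod_unfold)
qed

theorem theorem4p1:
  fixes lam :: "nat list" and z :: "int \<Rightarrow> complex"
  assumes "is_partition lam"
    and "\<And>i j. (i, j) \<in> young_diagram lam \<Longrightarrow> Re (z (int j - int i)) \<ge> 1"
    and "\<And>i. 1 \<le> i \<Longrightarrow> i \<le> frob_N lam \<Longrightarrow> Re (z (int (frob_p lam i))) > 1"
    and "\<And>i. 1 \<le> i \<Longrightarrow> i \<le> frob_N lam \<Longrightarrow> Re (z (- int (frob_q lam i))) > 1"
  shows "schur_mzf lam (\<lambda>(i, j). z (int j - int i)) =
    (\<Sum>\<sigma> | \<sigma> permutes {1..frob_N lam}. of_int (sign \<sigma>) *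
       (\<Sum>jj \<in> Pi\<^sub>E {1..frob_N lam} (\<lambda>k. {0..frob_q lam k}).
          (-1) ^ (\<Sum>k\<in>{1..frob_N lam}. jj k) *
          (\<Prod>k\<in>{1..frob_N lam}. mzf_star (map z [- int (jj k) .. int (frob_p lam (\<sigma> k))])) *
          (\<Prod>k\<in>{1..frob_N lam}. mzf (map (\<lambda>t. z (- int t)) [Suc (jj k) ..< Suc (frob_q lam k)]))))"
proof -
  let ?N = "frob_N lam"
  let ?x = "\<lambda>m c. zeta_weight m (z c)"
  have arm: "1 \<le> Re (z (int t))" if "i \<in> {1..?N}" "t \<le> frob_p lam i" for i t
    using assms(2)[OF content_arm[OF assms(1) that]] by simp
  have leg: "1 \<le> Re (z (- int t))" if "i \<in> {1..?N}" "t \<le> frob_q lam i" for i t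
    using assms(2)[OF content_leg[OF assms(1) that]] by simp
  \<comment> \<open>The interval starts on leg \<open>k\<close> and ends on arm \<open>i\<close>,
    which differ in general: negative contents are checked on the one, the others on the
    other.\<close>
  have star: "(\<lambda>n. chain_sum (\<le>) ?x n [- int j .. int (frob_p lam i)])
      \<longlonglongrightarrow> mzf_star (map z [- int j .. int (frob_p lam i)])"
    if i: "i \<in> {1..?N}" and k: "k \<in> {1..?N}" and j: "j \<le> frob_q lam k" for i j k
  proof -
    have "(\<lambda>n. chain_sum (\<le>) zeta_weight n (map z [- int j .. int (frob_p lam i)]))
        \<longlonglongrightarrow> mzf_star (map z [- int j .. int (frob_p lam i)])"
      unfolding mzf_star_def
    proof (rule chain_sum_tendsto)
      fix t assume "t \<in> set (map z [- int j .. int (frob_p lam i)])"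
      then obtain c where c: "t = z c" "- int j \<le> c" "c \<le> int (frob_p lam i)" by auto
      show "1 \<le> Re t"
      proof (cases "0 \<le> c")
        case True
        with c arm[OF i, of "nat c"] show ?thesis by simp
      next
        case False
        with c j leg[OF k, of "nat (- c)"] show ?thesis by simp
      qed
    next
      have "[- int j .. int (frob_p lam i)] = [- int j .. int (frob_p lam i) - 1] @ [int (frob_p lam i)]"
        by (rule upto_rec2) simp
      then show "1 < Re (last (map z [- int j .. int (frob_p lam i)]))"
        using assms(3)[of i] i by simp
    qed
    then show ?thesis by (simp add: chain_sum_map)
  qed
  have euler: "(\<lambda>n. chain_sum (<) ?x n (map (\<lambda>t. - int t) [Suc j ..< Suc (frob_q lam k)]))
      \<longlonglongrightarrow> mzf (map (\<lambda>t. z (- int t)) [Suc j ..< Suc (frob_q lam k)])"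
    if k: "k \<in> {1..?N}" for j k
  proof -
    have "(\<lambda>n. chain_sum (<) zeta_weight n (map (\<lambda>t. z (- int t)) [Suc j ..< Suc (frob_q lam k)]))
        \<longlonglongrightarrow> mzf (map (\<lambda>t. z (- int t)) [Suc j ..< Suc (frob_q lam k)])"
      unfolding mzf_def
    proof (rule chain_sum_tendsto)
      fix t assume "t \<in> set (map (\<lambda>t. z (- int t)) [Suc j ..< Suc (frob_q lam k)])"
      then show "1 \<le> Re t" using leg[OF k] by auto
    next
      assume "map (\<lambda>t. z (- int t)) [Suc j ..< Suc (frob_q lam k)] \<noteq> []"
      then show "1 < Re (last (map (\<lambda>t. z (- int t)) [Suc j ..< Suc (frob_q lam k)]))"
        using assms(4)[of k] k by (auto split: if_splits)
    qed simp
    then show ?thesis by (simp add: chain_sum_map)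
  qed
  have "(\<lambda>n. schur_sum ?x n (length lam) (part_row lam)) \<longlonglongrightarrow>
    (\<Sum>\<sigma> | \<sigma> permutes {1..?N}. of_int (sign \<sigma>) *
       (\<Sum>jj \<in> Pi\<^sub>E {1..?N} (\<lambda>k. {0..frob_q lam k}).
          (-1) ^ (\<Sum>k\<in>{1..?N}. jj k) *
          (\<Prod>k\<in>{1..?N}. mzf_star (map z [- int (jj k) .. int (frob_p lam (\<sigma> k))])) *
          (\<Prod>k\<in>{1..?N}. mzf (map (\<lambda>t. z (- int t)) [Suc (jj k) ..< Suc (frob_q lam k)]))))"
    \<comment> \<open>All sums and products in the truncated identity have finite index sets
      independent of the bound, so limits are taken factor by factor.\<close>
    unfolding giambelli_hooks[OF assms(1)]
  proof (intro tendsto_sum tendsto_mult tendsto_const tendsto_prod)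
    fix \<sigma> jj k
    assume "\<sigma> \<in> {\<sigma>. \<sigma> permutes {1..?N}}" and jj: "jj \<in> Pi\<^sub>E {1..?N} (\<lambda>k. {0..frob_q lam k})"
      and k: "k \<in> {1..?N}"
    then have "\<sigma> k \<in> {1..?N}" by (simp only: mem_Collect_eq permutes_in_image)
    moreover have "jj k \<le> frob_q lam k" using jj k by (auto simp: PiE_iff)
    ultimately show "(\<lambda>n. chain_sum (\<le>) ?x n [- int (jj k) .. int (frob_p lam (\<sigma> k))])
        \<longlonglongrightarrow> mzf_star (map z [- int (jj k) .. int (frob_p lam (\<sigma> k))])"
      using k by (intro star[where k = k])
  qed (rule euler)
  moreover have "(\<lambda>n. schur_sum ?x n (length lam) (part_row lam))
      \<longlonglongrightarrow> schur_mzf lam (\<lambda>(i, j). z (int j - int i))"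
    using assms by (intro schur_sum_tendsto) auto
  ultimately show ?thesis by (rule LIMSEQ_unique[rotated])
qed

end
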